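(* Let $r\geq 2$ be an integer, let $-\pi<\phi<\pi$, and let $a,w_1,\ldots,w_r\in\mathcal{H}_{\phi}$; put $\boldsymbol{w}=(w_1,\ldots,w_r)$. For each $j=1,\ldots,r-1$, let the constants $d_{j,n}$ $(n=-1,0,1,\ldots)$ be defined by \[ \frac{1}{(s)_j}=\sum_{n=-1}^{\infty}d_{j,n}s^n,\qquad (s)_j=s(s+1)\cdots(s+j-1), \] where the expansion is valid for $0<|s|<1$. Then, for $j=1,\ldots,r-1$ and $k=-1,0,1,2,\ldots$, the Laurent coefficients $\gamma_k(j,a;\boldsymbol{w})$ of the Barnes multiple zeta function $\zeta_r(s,a;\boldsymbol{w})$ at $s=j$ satisfy \[ \gamma_k(j,a;\boldsymbol{w})=(-1)^j\sum_{m=0}^{k+1}d_{j,k-m}\frac{1}{m!}\frac{\partial^j}{\partial a^j}\zeta_r^{(m)}(0,a;\boldsymbol{w}). \] Here $\zeta_r^{(m)}$ denotes the $m$-th derivative with respect to $s$, and $\partial^j/\partial a^j$ denotes holomorphic differentiation in $a\in\mathcal{H}_{\phi}$ with $\boldsymbol{w}$ fixed.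
   Context: For a fixed real number $-\pi<\phi<\pi$, $\mathcal{H}_{\phi}=\{\rho e^{i\theta}\in\mathbb{C}: \rho>0,\ \phi-\frac{\pi}{2}<\theta<\phi+\frac{\pi}{2}\}$ is an open half-plane. A fixed, otherwise arbitrary, holomorphic logarithm $\log$ on $\mathcal{H}_{\phi}$ is used throughout, with $z^s=\exp(s\log z)$ for $z\in\mathcal{H}_{\phi}$, $s\in\mathbb{C}$. For $a,w_1,\ldots,w_r\in\mathcal{H}_{\phi}$, the Barnes multiple zeta function is \[ \zeta_r(s,a;\boldsymbol{w})=\sum_{m_1=0}^{\infty}\cdots\sum_{m_r=0}^{\infty}(a+m_1w_1+\cdots+m_rw_r)^{-s}, \] which converges absolutely for $\operatorname{Re}s>r$ and continues meromorphically to all $s\in\mathbb{C}$, with only possible singularities simple poles at $s=1,\ldots,r$ (in particular it is holomorphic at $s=0$); the symbol $\zeta_r$ denotes the continued function. The Laurent coefficients at $s=j$ ($1\le j\le r$) are defined by \[ \zeta_r(s,a;\boldsymbol{w})=\sum_{k=-1}^\infty\gamma_k(j,a;\boldsymbol{w})(s-j)^k \] for $s$ near $j$, $s\ne j$, so $\gamma_{-1}(j,a;\boldsymbol{w})=\operatorname{Res}_{s=j}\zeta_r(s,a;\boldsymbol{w})$, which may be zero. *)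

theory Defs
  imports "HOL-Complex_Analysis.Complex_Analysis"
begin

definition barnes_halfplane :: "real \<Rightarrow> complex set" where
  "barnes_halfplane \<phi> = {complex_of_real \<rho> * cis \<theta> | \<rho> \<theta>. \<rho> > 0 \<and> \<phi> - pi / 2 < \<theta> \<and> \<theta> < \<phi> + pi / 2}"

definition is_holo_log :: "(complex \<Rightarrow> complex) \<Rightarrow> complex set \<Rightarrow> bool" where
  "is_holo_log L A \<longleftrightarrow> L holomorphic_on A \<and> (\<forall>z\<in>A. exp (L z) = z)"

definition log_power :: "(complex \<Rightarrow> complex) \<Rightarrow> complex \<Rightarrow> complex \<Rightarrow> complex" where
  "log_power L z s = exp (s * L z)"

text \<open>
  The tuple \<open>(w\<^sub>1, \<dots>, w\<^sub>r)\<close> is represented by the values of \<open>w\<close> on \<open>{1..r}\<close>, and the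
  \<open>r\<close>-fold series is the unordered sum over all multi-indices \<open>m : {1..r} \<rightarrow> \<nat>\<close>.
  The series converges absolutely for \<open>Re s > r\<close>, and is only used there.
\<close>
definition barnes_series ::
  "(complex \<Rightarrow> complex) \<Rightarrow> nat \<Rightarrow> (nat \<Rightarrow> complex) \<Rightarrow> complex \<Rightarrow> complex \<Rightarrow> complex" where
  "barnes_series L r w a s =
     (\<Sum>\<^sub>\<infinity>m \<in> {1..r} \<rightarrow>\<^sub>E (UNIV :: nat set).
        log_power L (a + (\<Sum>i=1..r. of_nat (m i) * w i)) (-s))"

text \<open>
  The function \<open>s \<mapsto> \<zeta>\<^sub>r(s, a; w)\<close> is the meromorphic continuation of the series to the whole
  plane. Requiring it to be \<^const>\<open>nicely_meromorphic_on\<close> (no removable singularities, value 0 at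
  poles) makes it unique as a total function.
\<close>
definition barnes_zeta ::
  "(complex \<Rightarrow> complex) \<Rightarrow> nat \<Rightarrow> (nat \<Rightarrow> complex) \<Rightarrow> complex \<Rightarrow> complex \<Rightarrow> complex" where
  "barnes_zeta L r w a =
     (THE f. f nicely_meromorphic_on UNIV \<and>
             (\<forall>s. Re s > real r \<longrightarrow> f s = barnes_series L r w a s))"

definition barnes_gamma ::
  "(complex \<Rightarrow> complex) \<Rightarrow> nat \<Rightarrow> (nat \<Rightarrow> complex) \<Rightarrow> int \<Rightarrow> nat \<Rightarrow> complex \<Rightarrow> complex" where
  "barnes_gamma L r w k j a = fls_nth (laurent_expansion (barnes_zeta L r w a) (of_nat j)) k"

end

theory Submission
  imports Defs
begin

text \<open>
  Since \<open>d/dz z\<^sup>-\<^sup>s = -s z\<^sup>-\<^sup>s\<^sup>-\<^sup>1\<close>, termwise differentiation of the Barnes series gives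
  \<open>\<partial>\<zeta>\<^sub>r(s, a)/\<partial>a = -s \<zeta>\<^sub>r(s + 1, a)\<close>, and iterating this,
  \<open>\<partial>\<^sup>j\<zeta>\<^sub>r(s, a)/\<partial>a\<^sup>j = (-1)\<^sup>j (s)\<^sub>j \<zeta>\<^sub>r(s + j, a)\<close>. If this identity survives analytic
  continuation, then near \<open>s = 0\<close> it reads
  \<open>\<zeta>\<^sub>r(j + s, a) = (-1)\<^sup>j \<cdot> 1/(s)\<^sub>j \<cdot> \<partial>\<^sup>j\<zeta>\<^sub>r(s, a)/\<partial>a\<^sup>j\<close>, where the last factor is holomorphic in \<open>s\<close>.
  The theorem is the Cauchy product of the Laurent series of \<open>1/(s)\<^sub>j\<close> with the Taylor series of that
  factor; its \<open>m\<close>-th Taylor coefficient is \<open>1/m!\<close> times the \<open>j\<close>-th \<open>a\<close>-derivative of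
  \<open>\<zeta>\<^sub>r\<^sup>(\<^sup>m\<^sup>)(0, a)\<close>, because the derivatives in \<open>s\<close> and in \<open>a\<close> commute.

  The work lies in a continuation that keeps track of both variables. Let
  \<open>P\<^sub>r(s) = (s - 1)\<dots>(s - r)\<close> and \<open>G\<^sub>r(s, a) = P\<^sub>r(s) \<zeta>\<^sub>r(s, a)\<close>. Far to the right, one integration by
  parts along the segment from \<open>a\<close> to \<open>a + w\<^sub>r\<close>, together with
  \<open>\<zeta>\<^sub>r(s, a) - \<zeta>\<^sub>r(s, a + w\<^sub>r) = \<zeta>\<^sub>r\<^sub>-\<^sub>1(s, a)\<close>, gives the exact identity
  \<open>G\<^sub>r(s, a) = G\<^sub>r\<^sub>-\<^sub>1(s - 1, a)/w\<^sub>r + w\<^sub>r (s - r) \<integral>\<^sub>0\<^sup>1 (1 - t) G\<^sub>r(s + 1, a + t w\<^sub>r) dt\<close>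
  (lemma \<open>barnes_series_recursion\<close>). Its right-hand side only needs \<open>G\<^sub>r\<close> one unit further to the
  right, and it contains no division by a function of \<open>s\<close>. Reading it as a definition extends \<open>G\<^sub>r\<close> one
  unit to the left at a time; by induction on \<open>r\<close>, all \<open>G\<^sub>r\<close> are entire in \<open>s\<close>. Joint continuity,
  holomorphy in \<open>s\<close>, and the differential relation, which for \<open>G\<^sub>r\<close> becomes
  \<open>\<partial>G\<^sub>r(s, a)/\<partial>a = (r - s) G\<^sub>r(s + 1, a)\<close>, all pass through the integral (lemma
  \<open>zeta_ladder_recursion_rhs\<close>). So the continued function inherits the relation by construction
  (theorem \<open>barnes_continuation\<close>). In particular the poles of \<open>\<zeta>\<^sub>r = G\<^sub>r/P\<^sub>r\<close> are among \<open>1, \<dots>, r\<close>, and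
  on the disc \<open>\<bar>s\<bar> < 1\<close> Cauchy's formula lets the derivatives in \<open>s\<close> and \<open>a\<close> be exchanged.
\<close>

section \<open>Integrals depending on a complex parameter\<close>

text \<open>
  By Fubini, the integral over a triangle in \<open>A\<close> vanishes because it does so for every fixed \<open>t\<close>, and
  Morera's theorem applies.
\<close>
lemma holomorphic_on_integral_param:
  fixes f :: "complex \<Rightarrow> real \<Rightarrow> complex"
  assumes A: "open A"
    and cont: "continuous_on (A \<times> {0..1}) (\<lambda>(s, t). f s t)"
    and hol: "\<And>t. t \<in> {0..1} \<Longrightarrow> (\<lambda>s. f s t) holomorphic_on A"
  shows "(\<lambda>s. integral {0..1} (f s)) holomorphic_on A"
proof -
  \<comment> \<open>Writing the integral as a contour integral over \<open>[0, 1]\<close> makes Fubini for contours applicable.\<close>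
  have lin: "contour_integral (linepath 0 1) (\<lambda>z. f s (Re z)) = integral {0..1} (f s)" for s
    by (simp add: contour_integral_integral linepath_def)
  have contF: "continuous_on A (\<lambda>s. integral {0..1} (f s))"
    using integral_continuous_on_param[of A 0 1 f] cont by simp
  have cint: "(\<lambda>s. integral {0..1} (f s)) contour_integrable_on linepath p q"
    if "closed_segment p q \<subseteq> A" for p q
    using that contF by (intro contour_integrable_continuous_linepath continuous_on_subset[OF contF])
  have triangle: "contour_integral (linepath a b) (\<lambda>s. integral {0..1} (f s)) +
      contour_integral (linepath b c) (\<lambda>s. integral {0..1} (f s)) + 
      contour_integral (linepath c a) (\<lambda>s. integral {0..1} (f s)) = 0" if "convex hull {a, b, c} \<subseteq> A" for a b c
  proof -
    let ?g = "linepath a b +++ linepath b c +++ linepath c a"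
    have seg: "closed_segment a b \<subseteq> A" "closed_segment b c \<subseteq> A" "closed_segment c a \<subseteq> A"
      using that segments_subset_convex_hull[where a = a and b = b and c = c] by blast+
    have swap: "contour_integral (linepath p q) (\<lambda>s. integral {0..1} (f s)) =
        contour_integral (linepath 0 1) (\<lambda>z. contour_integral (linepath p q) (\<lambda>s. f s (Re z)))"
      if "closed_segment p q \<subseteq> A" for p q
      unfolding lin[symmetric]
    proof (rule contour_integral_swap)
      have "continuous_on (closed_segment p q \<times> closed_segment 0 1) ((\<lambda>(s, t). f s t) \<circ> (\<lambda>(s, z). (s, Re z)))"
      proof (rule continuous_on_compose)
        show "continuous_on (closed_segment p q \<times> closed_segment 0 1) (\<lambda>(s, z). (s, Re z))"
          by (auto simp: split_beta intro!: continuous_intros)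
        have "Re z \<in> {0..1}" if "z \<in> closed_segment 0 1" for z
          using that by (auto simp: in_segment)
        then show "continuous_on ((\<lambda>(s, z). (s, Re z)) ` (closed_segment p q \<times> closed_segment 0 1)) (\<lambda>(s, t). f s t)"
          using \<open>closed_segment p q \<subseteq> A\<close> by (intro continuous_on_subset[OF cont]) auto
      qed
      then show "continuous_on (path_image (linepath p q) \<times> path_image (linepath 0 1)) (\<lambda>(s, z). f s (Re z))"
        by (simp add: o_def split_beta)
    qed auto
    have cint2: "(\<lambda>z. contour_integral (linepath p q) (\<lambda>s. f s (Re z))) contour_integrable_on linepath 0 1"
      if pq: "closed_segment p q \<subseteq> A" for p q
    proof (rule contour_integrable_continuous_linepath)
      have "continuous_on (closed_segment 0 1 \<times> {0..1::real}) (\<lambda>(z,t). f (linepath p q t) (Re z) * (q - p))"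
      proof -
        have "continuous_on (closed_segment 0 1 \<times> {0..1::real}) ((\<lambda>(s, t). f s t) \<circ> (\<lambda>(z, t). (linepath p q t, Re z)))"
        proof (rule continuous_on_compose)
          show "continuous_on (closed_segment 0 1 \<times> {0..1::real}) (\<lambda>(z, t). (linepath p q t, Re z))"
            by (auto simp: split_beta linepath_def intro!: continuous_intros)
          have "Re z \<in> {0..1}" if "z \<in> closed_segment 0 1" for z
            using that by (auto simp: in_segment)
          moreover have "linepath p q t \<in> A" if "t \<in> {0..1}" for t
            using pq that linepath_in_path by blast
          ultimately show "continuous_on ((\<lambda>(z, t). (linepath p q t, Re z)) ` (closed_segment 0 1 \<times> {0..1::real})) (\<lambda>(s, t). f s t)"
            by (intro continuous_on_subset[OF cont]) auto
        qed
        then show ?thesis by (auto simp: o_def split_beta intro!: continuous_intros)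
      qed
      from integral_continuous_on_param[of "closed_segment 0 1" 0 1 "\<lambda>z t. f (linepath p q t) (Re z) * (q - p)"] this
      show "continuous_on (closed_segment 0 1) (\<lambda>z. contour_integral (linepath p q) (\<lambda>s. f s (Re z)))"
        by (simp add: contour_integral_integral)
    qed
    have inner: "contour_integral (linepath a b) (\<lambda>s. f s (Re z)) + 
       (contour_integral (linepath b c) (\<lambda>s. f s (Re z)) + contour_integral (linepath c a) (\<lambda>s. f s (Re z))) = 0"
      if "z \<in> closed_segment 0 1" for z :: complex
    proof -
      have z: "Re z \<in> {0..1}"
        using that by (auto simp: in_segment)
      have "((\<lambda>s. f s (Re z)) has_contour_integral 0) ?g"
        using hol[OF z] \<open>convex hull {a, b, c} \<subseteq> A\<close>
        by (intro Cauchy_theorem_triangle) (auto intro: holomorphic_on_subset)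
      then have eq0: "contour_integral ?g (\<lambda>s. f s (Re z)) = 0"
        by (rule contour_integral_unique)
      have int: "(\<lambda>s. f s (Re z)) contour_integrable_on linepath p q" if "closed_segment p q \<subseteq> A" for p q
        using that hol[OF z] 
        by (intro contour_integrable_continuous_linepath) (meson continuous_on_subset holomorphic_on_imp_continuous_on)
      show ?thesis
        using eq0 int[OF seg(1)] int[OF seg(2)] int[OF seg(3)] by simp
    qed
    have "contour_integral (linepath a b) (\<lambda>s. integral {0..1} (f s)) +
        contour_integral (linepath b c) (\<lambda>s. integral {0..1} (f s)) + 
        contour_integral (linepath c a) (\<lambda>s. integral {0..1} (f s)) =
      contour_integral (linepath 0 1) (\<lambda>z. contour_integral (linepath a b) (\<lambda>s. f s (Re z)) + 
        (contour_integral (linepath b c) (\<lambda>s. f s (Re z)) + contour_integral (linepath c a) (\<lambda>s. f s (Re z))))"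
      using seg by (simp only: swap cint2 contour_integral_add contour_integrable_add add.assoc)
    also have "\<dots> = contour_integral (linepath 0 1) (\<lambda>z. 0)"
      by (rule contour_integral_eq) (use inner in auto)
    finally show ?thesis by simp
  qed
  have "(\<lambda>s. integral {0..1} (f s)) analytic_on A"
    using A contF triangle by (intro Morera_triangle) blast+
  then show ?thesis by (rule analytic_imp_holomorphic)
qed

text \<open>
  Derivatives in the two variables commute: Cauchy's formula turns the \<open>m\<close>-th derivative at \<open>z\<close> into an
  integral of \<open>F\<close> itself over a fixed circle, and there the parameter can be differentiated under the
  integral sign.
\<close>
lemma higher_deriv_param_deriv:
  fixes F F' :: "complex \<Rightarrow> complex \<Rightarrow> complex"
  assumes T: "open T" "convex T" "b \<in> T" and R: "R > 0"
    and cont: "continuous_on (ball z R \<times> T) (\<lambda>(u, b). F u b)" "continuous_on (ball z R \<times> T) (\<lambda>(u, b). F' u b)"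
    and hol: "\<And>b. b \<in> T \<Longrightarrow> (\<lambda>u. F u b) holomorphic_on ball z R" "\<And>b. b \<in> T \<Longrightarrow> (\<lambda>u. F' u b) holomorphic_on ball z R"
    and der: "\<And>u b. u \<in> ball z R \<Longrightarrow> b \<in> T \<Longrightarrow> (F u has_field_derivative F' u b) (at b)"
  shows "((\<lambda>b. (deriv ^^ m) (\<lambda>u. F u b) z) has_field_derivative (deriv ^^ m) (\<lambda>u. F' u b) z) (at b)"
proof -
  \<comment> \<open>\<open>v\<close> is the velocity of the circle \<open>g\<close>.\<close>
  define g where "g = circlepath z (R / 2)"
  define v where "v t = 2 * pi * \<i> * (R / 2) * exp (2 * of_real pi * \<i> * of_real t)" for t :: real
  have gt: "g t \<in> ball z R" "g t \<noteq> z" for t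
    using R by (auto simp: g_def circlepath_def part_circlepath_def linepath_def dist_norm norm_mult)
  have contg: "continuous_on X g" for X
    unfolding g_def circlepath_def part_circlepath_def linepath_def by (intro continuous_intros)
  have contv: "continuous_on X v" for X
    unfolding v_def by (intro continuous_intros)
  have Cauchy: "(deriv ^^ m) f z = fact m / (2 * pi * \<i>) * integral {0..1} (\<lambda>t. f (g t) / (g t - z) ^ Suc m * v t)"
    if "f holomorphic_on ball z R" for f
  proof -
    have "f holomorphic_on ball z (R / 2)" "continuous_on (cball z (R / 2)) f"
      using that R by (auto intro!: holomorphic_on_imp_continuous_on elim!: holomorphic_on_subset)
    then have "(deriv ^^ m) f z = fact m / (2 * pi * \<i>) * contour_integral g (\<lambda>u. f u / (u - z) ^ Suc m)"
      unfolding g_def using R by (intro Cauchy_higher_derivative_integral_circlepath(2)) auto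
    also have "contour_integral g (\<lambda>u. f u / (u - z) ^ Suc m) = integral {0..1} (\<lambda>t. f (g t) / (g t - z) ^ Suc m * v t)"
      unfolding contour_integral_integral
      by (intro integral_cong) (auto simp: g_def v_def vector_derivative_circlepath)
    finally show ?thesis .
  qed
  have contF: "continuous_on (T \<times> {0..1}) (\<lambda>x. f (g (snd x)) (fst x) / (g (snd x) - z) ^ Suc m * v (snd x))"
    if "continuous_on (ball z R \<times> T) (\<lambda>(u, b). f u b)" for f
    using continuous_on_compose2[OF that[unfolded case_prod_unfold], of "T \<times> {0..1}" "\<lambda>x. (g (snd x), fst x)"] gt
    by (force intro!: continuous_intros continuous_on_compose2[OF contg] continuous_on_compose2[OF contv])
  have "((\<lambda>b. integral (cbox 0 1) (\<lambda>t. F (g t) b / (g t - z) ^ Suc m * v t)) has_field_derivative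
      integral (cbox 0 1) (\<lambda>t. F' (g t) b / (g t - z) ^ Suc m * v t)) (at b within T)"
  proof (rule leibniz_rule_field_derivative)
    show "((\<lambda>b. F (g t) b / (g t - z) ^ Suc m * v t) has_field_derivative F' (g t) b / (g t - z) ^ Suc m * v t) (at b within T)"
      if "b \<in> T" for b t
      using DERIV_cmult_right[OF DERIV_cdivide[OF der[OF gt(1) that]]] has_field_derivative_at_within by blast
    show "(\<lambda>t. F (g t) b / (g t - z) ^ Suc m * v t) integrable_on cbox 0 1" if "b \<in> T" for b
    proof (intro integrable_continuous)
      show "continuous_on (cbox 0 1) (\<lambda>t. F (g t) b / (g t - z) ^ Suc m * v t)"
        using continuous_on_compose2[OF contF[OF cont(1)], of "cbox 0 1" "\<lambda>t. (b, t)"] that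
        by (force intro!: continuous_intros)
    qed
    show "continuous_on (T \<times> cbox 0 1) (\<lambda>(b, t). F' (g t) b / (g t - z) ^ Suc m * v t)"
      using contF[OF cont(2)] by (simp add: case_prod_unfold)
  qed (use T in auto)
  then have "((\<lambda>b. fact m / (2 * pi * \<i>) * integral {0..1} (\<lambda>t. F (g t) b / (g t - z) ^ Suc m * v t)) has_field_derivative
      (deriv ^^ m) (\<lambda>u. F' u b) z) (at b)"
    unfolding Cauchy[OF hol(2)[OF T(3)]] using at_within_open[OF T(3,1)] by (intro DERIV_cmult) simp
  then show ?thesis
    by (rule has_field_derivative_transform_within_open[OF _ T(1,3)]) (simp add: Cauchy[OF hol(1)])
qed

section \<open>Half-planes and their logarithms\<close>

text \<open>
  Rotation by \<open>-\<phi>\<close> takes the half-plane to the right half-plane. In this form it is visibly open,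
  convex, and closed under addition and positive scaling.
\<close>
lemma barnes_halfplane_eq: 
  assumes "-pi < \<phi>" "\<phi> < pi"
  shows "barnes_halfplane \<phi> = {z. 0 < Re (cis (-\<phi>) * z)}"
proof (intro set_eqI iffI)
  fix z assume "z \<in> barnes_halfplane \<phi>"
  then obtain \<rho> \<theta> where z: "z = of_real \<rho> * cis \<theta>" "\<rho> > 0" "\<phi> - pi / 2 < \<theta>" "\<theta> < \<phi> + pi / 2"
    by (auto simp: barnes_halfplane_def)
  have "cis (-\<phi>) * z = of_real \<rho> * cis (\<theta> - \<phi>)"
    by (simp add: z(1) cis_mult mult.left_commute)
  then have "Re (cis (-\<phi>) * z) = \<rho> * cos (\<theta> - \<phi>)"
    by (simp only: Re_complex_of_real mult.commute) simp
  moreover have "cos (\<theta> - \<phi>) > 0"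
    using z by (intro cos_gt_zero_pi) auto
  ultimately show "z \<in> {z. 0 < Re (cis (-\<phi>) * z)}"
    using z by (simp only: mem_Collect_eq mult_pos_pos)
next
  fix z assume "z \<in> {z. 0 < Re (cis (-\<phi>) * z)}"
  then have pos: "0 < Re (cis (-\<phi>) * z)" by simp
  define u where "u = cis (-\<phi>) * z"
  have nz: "u \<noteq> 0" using pos by (auto simp: u_def)
  have "\<bar>Im (Ln u)\<bar> < pi / 2"
    using pos nz Re_Ln_pos_lt by (simp add: u_def)
  moreover have "u = of_real (norm u) * cis (Im (Ln u))"
    using nz by (metis Arg_eq Arg_eq_Im_Ln cis_conv_exp)
  then have "cis \<phi> * u = of_real (norm u) * cis (Im (Ln u) + \<phi>)"
    by (metis ab_semigroup_mult_class.mult_ac(1) cis_mult mult.commute)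
  then have "z = of_real (norm u) * cis (Im (Ln u) + \<phi>)"
    by (simp add: u_def cis_mult flip: mult.assoc)
  ultimately show "z \<in> barnes_halfplane \<phi>"
    unfolding barnes_halfplane_def mem_Collect_eq using nz
    by (intro exI[of _ "norm u"] exI[of _ "Im (Ln u) + \<phi>"]) auto
qed

locale log_on_halfplane =
  fixes \<phi> :: real and L :: "complex \<Rightarrow> complex" 
  assumes phi: "-pi < \<phi>" "\<phi> < pi"
    and holo_log: "is_holo_log L (barnes_halfplane \<phi>)"
begin

abbreviation "H \<equiv> barnes_halfplane \<phi>"

text \<open>
  The distance to the boundary line, with sign. It is additive, so it bounds the points
  \<open>a + m\<^sub>1w\<^sub>1 + \<dots> + m\<^sub>rw\<^sub>r\<close> away from the origin linearly in \<open>m\<close>.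
\<close>
definition height :: "complex \<Rightarrow> real" where "height z = Re (cis (-\<phi>) * z)"

lemma H_iff: "z \<in> H \<longleftrightarrow> 0 < height z"
  using barnes_halfplane_eq[OF phi] by (simp add: height_def)

lemma height_add: "height (x + y) = height x + height y"
  by (simp add: height_def distrib_left)

lemma height_of_real_mult: "height (of_real c * x) = c * height x"
  by (simp add: height_def algebra_simps)

lemma height_of_nat_mult: "height (of_nat n * x) = of_nat n * height x"
  using height_of_real_mult[of "of_nat n" x] by simp

lemma height_sum: "height (\<Sum>i\<in>I. f i) = (\<Sum>i\<in>I. height (f i))"
  by (simp add: height_def sum_distrib_left)

lemma height_le_norm: "height z \<le> norm z"
  unfolding height_def by (metis complex_Re_le_cmod mult.left_neutral norm_cis norm_mult)

lemma continuous_height: "continuous_on A height"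
  unfolding height_def by (intro continuous_intros)

lemma open_height: "open {z. c < height z}"
  by (intro open_Collect_less continuous_height continuous_intros)

lemma open_H: "open H"
proof -
  have "H = {z. 0 < height z}" using H_iff by blast
  then show ?thesis using open_height[of 0] by simp
qed

lemma convex_H: "convex H"
proof (rule convexI)
  fix x y u v assume "x \<in> H" "y \<in> H" and uv: "0 \<le> (u::real)" "0 \<le> v" "u + v = 1"
  then have pos: "0 < height x" "0 < height y" by (auto simp: H_iff)
  have "0 < u * height x + v * height y"
  proof (cases "u = 0")
    case True
    with uv pos show ?thesis by simp
  next
    case False
    with uv pos show ?thesis by (intro add_pos_nonneg mult_pos_pos mult_nonneg_nonneg) auto
  qed
  then show "u *\<^sub>R x + v *\<^sub>R y \<in> H"
    by (simp add: H_iff height_add scaleR_conv_of_real height_of_real_mult)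
qed

lemma H_ray: "a \<in> H \<Longrightarrow> w \<in> H \<Longrightarrow> t \<ge> 0 \<Longrightarrow> a + of_real t * w \<in> H"
  by (simp add: H_iff height_add height_of_real_mult add_pos_nonneg)

lemma exp_L: "z \<in> H \<Longrightarrow> exp (L z) = z"
  using holo_log by (auto simp: is_holo_log_def)

lemma nonzero_H: "z \<in> H \<Longrightarrow> z \<noteq> 0"
  by (auto simp: H_iff height_def)

lemma L_deriv: assumes "z \<in> H" shows "(L has_field_derivative 1 / z) (at z)"
proof -
  have "L holomorphic_on H" using holo_log by (auto simp: is_holo_log_def)
  then have L: "(L has_field_derivative deriv L z) (at z)"
    using assms open_H holomorphic_derivI by blast
  then have "((\<lambda>x. exp (L x)) has_field_derivative exp (L z) * deriv L z) (at z)"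
    by (auto intro!: derivative_eq_intros)
  moreover have "((\<lambda>x. exp (L x)) has_field_derivative 1) (at z)"
    by (rule has_field_derivative_transform_within_open[OF DERIV_ident open_H assms]) 
       (simp add: exp_L)
  ultimately have "exp (L z) * deriv L z = 1" by (rule DERIV_unique)
  with exp_L[OF assms] nonzero_H[OF assms] have "deriv L z = 1 / z" by (simp add: field_simps)
  with L show ?thesis by simp
qed

lemma continuous_L: "continuous_on H L"
  using L_deriv by (meson DERIV_isCont continuous_at_imp_continuous_on)

text \<open>
  Two logarithms on a connected set differ by a constant, and the principal one, after the rotation,
  has imaginary part in \<open>(-\<pi>/2, \<pi>/2)\<close>. So, locally uniformly in \<open>s\<close>, the size \<open>\<bar>z\<^sup>-\<^sup>s\<bar>\<close> is
  comparable with \<open>\<bar>z\<bar>\<close> to the power \<open>-Re s\<close>.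
\<close>
lemma Im_L_bounded: obtains C where "C \<ge> 0" "\<forall>z\<in>H. \<bar>Im (L z)\<bar> \<le> C"
proof -
  define D where "D z = L z - Ln (cis (-\<phi>) * z)" for z
  have "(D has_field_derivative 0) (at z within H)" if z: "z \<in> H" for z
  proof -
    have "cis (-\<phi>) * z \<notin> \<real>\<^sub>\<le>\<^sub>0"
      using z by (auto simp: H_iff height_def complex_nonpos_Reals_iff)
    then have "(D has_field_derivative 1 / z - inverse (cis (-\<phi>) * z) * cis (-\<phi>)) (at z)"
      unfolding D_def by (intro DERIV_diff L_deriv[OF z] DERIV_chain2[OF has_field_derivative_Ln])
        (auto intro!: derivative_eq_intros)
    moreover have "1 / z - inverse (cis (-\<phi>) * z) * cis (-\<phi>) = 0"
      using nonzero_H[OF z] by (simp add: field_simps)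
    ultimately show ?thesis using has_field_derivative_at_within by metis
  qed
  then obtain c where c: "\<And>z. z \<in> H \<Longrightarrow> D z = c"
    using has_field_derivative_zero_constant[OF convex_H] by metis
  show thesis
  proof (rule that[of "\<bar>Im c\<bar> + pi / 2"])
    show "\<forall>z\<in>H. \<bar>Im (L z)\<bar> \<le> \<bar>Im c\<bar> + pi / 2"
    proof
      fix z assume z: "z \<in> H"
      have "\<bar>Im (Ln (cis (-\<phi>) * z))\<bar> < pi / 2"
        using z nonzero_H[OF z] Re_Ln_pos_lt[of "cis (-\<phi>) * z"] by (simp add: H_iff height_def)
      then show "\<bar>Im (L z)\<bar> \<le> \<bar>Im c\<bar> + pi / 2"
        using c[OF z] by (auto simp: D_def complex_eq_iff)
    qed
  qed simp
qed

lemma Re_L: "z \<in> H \<Longrightarrow> Re (L z) = ln (norm z)"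
  using exp_L[of z] by (metis ln_exp norm_exp_eq_Re)

lemma log_power_deriv:
  assumes "z \<in> H"
  shows "((\<lambda>z. log_power L z (-s)) has_field_derivative - s * log_power L z (-(s + 1))) (at z)"
proof -
  have "-(s + 1) * L z = -s * L z - L z" by (simp add: algebra_simps)
  then have "log_power L z (-(s + 1)) = log_power L z (-s) / z"
    using exp_L[OF assms] by (simp only: log_power_def exp_diff)
  then show ?thesis
    unfolding log_power_def by (auto intro!: derivative_eq_intros L_deriv assms)
qed

end

section \<open>The Barnes series\<close>

text \<open>
  The sum is at least each of its \<open>r\<close> terms, so its power can be shared out evenly among the indices.
  This reduces convergence of the \<open>r\<close>-fold series for \<open>\<sigma> > r\<close> to that of one-dimensional series with
  exponent \<open>\<sigma>/r > 1\<close>.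
\<close>
lemma one_plus_sum_powr_le_prod:
  fixes m :: "nat \<Rightarrow> nat"
  assumes "\<sigma> \<ge> 0"
  shows "(1 + real (\<Sum>i=1..r. m i)) powr (-\<sigma>) \<le> (\<Prod>i=1..r. (1 + real (m i)) powr (-\<sigma> / real r))"
proof (cases "r = 0")
  case False
  define M where "M = 1 + real (\<Sum>i=1..r. m i)"
  have "M > 0" unfolding M_def using of_nat_0_le_iff[of "\<Sum>i=1..r. m i", where 'a = real] by linarith
  then have "M powr (-\<sigma> / real r) > 0" by (simp only: powr_gt_zero)
  from powr_realpow[OF this, of r] have "(M powr (-\<sigma> / real r)) ^ r = M powr (-\<sigma> / real r * real r)"
    by (simp only: powr_powr)
  also have "-\<sigma> / real r * real r = -\<sigma>" using False by simp
  finally have "M powr (-\<sigma>) = (M powr (-\<sigma> / real r)) ^ r" by (rule sym)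
  also have "\<dots> = (\<Prod>i=1..r. M powr (-\<sigma> / real r))"
    by simp
  also have "\<dots> \<le> (\<Prod>i=1..r. (1 + real (m i)) powr (-\<sigma> / real r))"
  proof (rule prod_mono, intro conjI powr_mono2')
    fix i assume "i \<in> {1..r}"
    then have "m i \<le> (\<Sum>i=1..r. m i)" by (intro member_le_sum) auto
    then show "1 + real (m i) \<le> M" unfolding M_def by linarith
  qed (use assms in auto)
  finally show ?thesis unfolding M_def .
qed simp

lemma summable_on_prod_powr:
  assumes "\<sigma> > real r"
  shows "(\<lambda>m. \<Prod>i=1..r. (1 + real (m i)) powr (-\<sigma> / real r)) summable_on ({1..r} \<rightarrow>\<^sub>E (UNIV :: nat set))"
proof -
  have "summable (\<lambda>n. (1 + real n) powr (-\<sigma> / real r))" if "r > 0"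
  proof -
    have "-\<sigma> / real r < -1" using assms that by (simp add: field_simps)
    then have "summable (\<lambda>n. real (Suc n) powr (-\<sigma> / real r))"
      by (subst summable_Suc_iff) (simp add: summable_real_powr_iff)
    then show ?thesis by (simp add: add.commute)
  qed
  then have "Infinite_Set_Sum.abs_summable_on (\<lambda>n::nat. (1 + real n) powr (-\<sigma> / real r)) UNIV" if "r > 0"
    using that by (simp add: abs_summable_on_nat_iff')
  then have "Infinite_Set_Sum.abs_summable_on 
     (\<lambda>m. \<Prod>i=1..r. (1 + real (m i)) powr (-\<sigma> / real r)) ({1..r} \<rightarrow>\<^sub>E (UNIV :: nat set))"
    by (intro abs_summable_on_prod_PiE) auto
  then show ?thesis
    using abs_summable_equivalent abs_summable_summable by blast
qed

context log_on_halfplane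
begin

definition lattice_point :: "nat \<Rightarrow> (nat \<Rightarrow> complex) \<Rightarrow> complex \<Rightarrow> (nat \<Rightarrow> nat) \<Rightarrow> complex" where
  "lattice_point r w a m = a + (\<Sum>i=1..r. of_nat (m i) * w i)"

lemma barnes_series_lattice_point:
  "barnes_series L r w a s = (\<Sum>\<^sub>\<infinity>m \<in> {1..r} \<rightarrow>\<^sub>E UNIV. log_power L (lattice_point r w a m) (-s))"
  by (simp add: barnes_series_def lattice_point_def)

lemma height_lattice_point_ge:
  assumes "0 < \<delta>" "\<delta> \<le> height a" "\<And>i. i \<in> {1..r} \<Longrightarrow> \<delta> \<le> height (w i)"
  shows "\<delta> * (1 + real (\<Sum>i=1..r. m i)) \<le> height (lattice_point r w a m)"
proof -
  have "(\<Sum>i=1..r. real (m i) * \<delta>) \<le> (\<Sum>i=1..r. real (m i) * height (w i))"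
    using assms by (intro sum_mono mult_left_mono) auto
  with assms(2) show ?thesis
    unfolding lattice_point_def height_add height_sum height_of_nat_mult of_nat_sum
    by (simp add: distrib_left sum_distrib_left mult.commute)
qed

lemma lattice_point_in_H:
  assumes "a \<in> H" "\<And>i. i \<in> {1..r} \<Longrightarrow> w i \<in> H"
  shows "lattice_point r w a m \<in> H"
  using assms unfolding lattice_point_def H_iff height_add height_sum height_of_nat_mult
  by (intro add_pos_nonneg sum_nonneg mult_nonneg_nonneg) (auto intro: less_imp_le)

lemma norm_log_power_le:
  assumes C: "\<And>z. z \<in> H \<Longrightarrow> \<bar>Im (L z)\<bar> \<le> C"
    and z: "z \<in> H" and \<delta>: "0 < \<delta>" "\<delta> \<le> 1" "\<delta> * n \<le> height z" "n \<ge> 1"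
    and s: "0 \<le> \<sigma>" "\<sigma> \<le> Re s" "norm s \<le> B"
  shows "norm (log_power L z (-s)) \<le> exp (B * C) * \<delta> powr (-B) * n powr (-\<sigma>)"
proof -
  have nz: "norm z > 0" using nonzero_H[OF z] by simp
  have "norm (log_power L z (-s)) = exp (Im s * Im (L z)) * norm z powr (- Re s)"
    using Re_L[OF z] nz by (simp add: log_power_def powr_def exp_add[symmetric] algebra_simps)
  also have "\<dots> \<le> exp (B * C) * (\<delta> powr (-B) * n powr (-\<sigma>))"
  proof (intro mult_mono)
    have "Im s * Im (L z) \<le> \<bar>Im s\<bar> * \<bar>Im (L z)\<bar>"
      by (metis abs_ge_self abs_mult)
    also have "\<dots> \<le> B * C"
      using C[OF z] s(3) abs_Im_le_cmod[of s] by (intro mult_mono) auto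
    finally show "exp (Im s * Im (L z)) \<le> exp (B * C)" by simp
    have "norm z powr (- Re s) \<le> (\<delta> * n) powr (- Re s)"
      using \<delta> s height_le_norm[of z] by (intro powr_mono2') (auto intro: mult_pos_pos)
    also have "\<dots> = \<delta> powr (- Re s) * n powr (- Re s)"
      using \<delta> by (simp add: powr_mult)
    also have "\<dots> \<le> \<delta> powr (-B) * n powr (-\<sigma>)"
      using \<delta> s complex_Re_le_cmod[of s] by (intro mult_mono powr_mono powr_mono') auto
    finally show "norm z powr (- Re s) \<le> \<delta> powr (-B) * n powr (-\<sigma>)" .
  qed auto
  finally show ?thesis by (simp add: mult.assoc)
qed

text \<open>
  One summable majorant that serves a whole neighbourhood of \<open>(s\<^sub>0, a\<^sub>0)\<close>: this is the only estimate on
  the series, and all its regularity in both variables follows from the Weierstrass test.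
\<close>
lemma barnes_series_local_majorant:
  assumes a0: "a0 \<in> H" and w: "\<And>i. i \<in> {1..r} \<Longrightarrow> w i \<in> H" and s0: "Re s0 > real r"
  obtains S A M where "open S" "s0 \<in> S" "open A" "a0 \<in> A" "A \<subseteq> H"
    "M summable_on ({1..r} \<rightarrow>\<^sub>E (UNIV :: nat set))"
    "\<forall>s\<in>S. \<forall>a\<in>A. \<forall>m. norm (log_power L (lattice_point r w a m) (-s)) \<le> M m"
proof -
  obtain C where "C \<ge> 0" and C': "\<forall>z\<in>H. \<bar>Im (L z)\<bar> \<le> C" by (rule Im_L_bounded)
  then have C: "\<And>z. z \<in> H \<Longrightarrow> \<bar>Im (L z)\<bar> \<le> C" by blast
  \<comment> \<open>Halving the height of \<open>a\<^sub>0\<close> leaves room for a neighbourhood; the bound 1 makes \<open>\<delta>\<close> to the power \<open>-Re s\<close>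
    monotone in \<open>Re s\<close>.\<close>
  define \<delta> where "\<delta> = Min (insert 1 (insert (height a0 / 2) ((\<lambda>i. height (w i)) ` {1..r})))"
  define \<sigma> where "\<sigma> = (Re s0 + real r) / 2"
  define B where "B = norm s0 + 1"
  have \<delta>: "\<delta> \<le> 1" "\<delta> \<le> height a0 / 2" "\<And>i. i \<in> {1..r} \<Longrightarrow> \<delta> \<le> height (w i)"
    unfolding \<delta>_def by (rule Min_le; simp)+
  have \<delta>0: "\<delta> > 0" unfolding \<delta>_def using a0 w by (subst Min_gr_iff) (auto simp: H_iff)
  have \<sigma>: "\<sigma> > real r" "\<sigma> < Re s0" using s0 by (auto simp: \<sigma>_def)
  define M where "M m = exp (B * C) * \<delta> powr (-B) * (\<Prod>i=1..r. (1 + real (m i)) powr (-\<sigma> / real r))" 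
    for m :: "nat \<Rightarrow> nat"
  show thesis
  proof (rule that[of "{s. \<sigma> < Re s} \<inter> ball 0 B" "{a. \<delta> < height a}" M])
    show "open ({s. \<sigma> < Re s} \<inter> ball 0 B)" by (intro open_Int open_halfspace_Re_gt open_ball)
    show "s0 \<in> {s. \<sigma> < Re s} \<inter> ball 0 B" using \<sigma> by (simp add: B_def)
    show "a0 \<in> {a. \<delta> < height a}" using \<delta>(2) a0 by (auto simp: H_iff)
    show "{a. \<delta> < height a} \<subseteq> H" using \<delta>0 by (auto simp: H_iff)
    show "M summable_on ({1..r} \<rightarrow>\<^sub>E (UNIV :: nat set))"
      unfolding M_def by (intro summable_on_cmult_right summable_on_prod_powr \<sigma>)
    show "\<forall>s\<in>{s. \<sigma> < Re s} \<inter> ball 0 B. \<forall>a\<in>{a. \<delta> < height a}. \<forall>m.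
      norm (log_power L (lattice_point r w a m) (-s)) \<le> M m"
    proof (intro ballI allI)
      fix s a m assume s: "s \<in> {s. \<sigma> < Re s} \<inter> ball 0 B" and a: "a \<in> {a. \<delta> < height a}"
      have aH: "a \<in> H" using a \<delta>0 by (simp add: H_iff)
      have "\<delta> * (1 + real (\<Sum>i=1..r. m i)) \<le> height (lattice_point r w a m)"
        using a \<delta>0 \<delta>(3) by (intro height_lattice_point_ge) auto
      then have "norm (log_power L (lattice_point r w a m) (-s)) 
            \<le> exp (B * C) * \<delta> powr (-B) * (1 + real (\<Sum>i=1..r. m i)) powr (-\<sigma>)"
        using s \<sigma>(1) \<delta>(1) \<delta>0 by (intro norm_log_power_le[OF C] lattice_point_in_H aH w) (auto intro: sum_nonneg)
      also have "\<dots> \<le> M m"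
        unfolding M_def using \<sigma> by (intro mult_left_mono one_plus_sum_powr_le_prod) auto
      finally show "norm (log_power L (lattice_point r w a m) (-s)) \<le> M m" .
    qed
  qed (rule open_height)
qed

lemma barnes_series_summable:
  assumes "a \<in> H" "\<And>i. i \<in> {1..r} \<Longrightarrow> w i \<in> H" "Re s > real r"
  shows "(\<lambda>m. log_power L (lattice_point r w a m) (-s)) summable_on ({1..r} \<rightarrow>\<^sub>E UNIV)"
proof -
  obtain S A M where M: "open S" "s \<in> S" "open A" "a \<in> A" "A \<subseteq> H"
    "M summable_on ({1..r} \<rightarrow>\<^sub>E (UNIV :: nat set))"
    "\<forall>s\<in>S. \<forall>a\<in>A. \<forall>m. norm (log_power L (lattice_point r w a m) (-s)) \<le> M m"
    by (rule barnes_series_local_majorant[OF assms])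
  show ?thesis
    by (rule abs_summable_summable, rule Infinite_Sum.abs_summable_on_comparison_test'[OF M(6)]) 
       (use M in auto)
qed

lemma barnes_series_tendsto_uniformly:
  assumes "M summable_on ({1..r} \<rightarrow>\<^sub>E (UNIV :: nat set))"
    "\<And>x m. x \<in> X \<Longrightarrow> norm (log_power L (lattice_point r w (g x) m) (- h x)) \<le> M m"
  shows "uniform_limit X (\<lambda>F x. \<Sum>m\<in>F. log_power L (lattice_point r w (g x) m) (- h x)) 
     (\<lambda>x. barnes_series L r w (g x) (h x)) (finite_subsets_at_top ({1..r} \<rightarrow>\<^sub>E UNIV))"
  unfolding barnes_series_lattice_point using assms by (intro Weierstrass_m_test_general) auto

lemma continuous_lattice_point: "continuous_on A (\<lambda>a. lattice_point r w a m)"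
  unfolding lattice_point_def by (intro continuous_intros)

lemma continuous_on_barnes_series:
  assumes w: "\<And>i. i \<in> {1..r} \<Longrightarrow> w i \<in> H"
  shows "continuous_on ({s. real r < Re s} \<times> H) (\<lambda>(s, a). barnes_series L r w a s)"
proof (rule continuous_at_imp_continuous_on, safe)
  fix s0 a0 assume s0: "real r < Re s0" and a0: "a0 \<in> H"
  obtain S A M where M: "open S" "s0 \<in> S" "open A" "a0 \<in> A" "A \<subseteq> H"
    "M summable_on ({1..r} \<rightarrow>\<^sub>E (UNIV :: nat set))"
    "\<forall>s\<in>S. \<forall>a\<in>A. \<forall>m. norm (log_power L (lattice_point r w a m) (-s)) \<le> M m"
    by (rule barnes_series_local_majorant[OF a0 w s0])
  have "continuous_on (S \<times> A) (\<lambda>x. barnes_series L r w (snd x) (fst x))"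
  proof (rule uniform_limit_theorem)
    show "uniform_limit (S \<times> A) (\<lambda>F x. \<Sum>m\<in>F. log_power L (lattice_point r w (snd x) m) (- fst x)) 
     (\<lambda>x. barnes_series L r w (snd x) (fst x)) (finite_subsets_at_top ({1..r} \<rightarrow>\<^sub>E UNIV))"
      using M by (intro barnes_series_tendsto_uniformly[of M]) auto
    have "continuous_on (S \<times> A) (\<lambda>x. log_power L (lattice_point r w (snd x) m) (- fst x))" for m
      unfolding log_power_def using M(5) w
      by (intro continuous_intros continuous_on_compose2[OF continuous_L] continuous_on_compose2[OF continuous_lattice_point[of UNIV]])
         (auto intro!: lattice_point_in_H)
    then show "\<forall>\<^sub>F F in finite_subsets_at_top ({1..r} \<rightarrow>\<^sub>E UNIV). 
        continuous_on (S \<times> A) (\<lambda>x. \<Sum>m\<in>F. log_power L (lattice_point r w (snd x) m) (- fst x))"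
      by (intro always_eventually allI continuous_on_sum) auto
  qed simp
  then show "isCont (\<lambda>(s, a). barnes_series L r w a s) (s0, a0)"
    using M(1-4) by (subst (asm) continuous_on_eq_continuous_at) (auto simp: open_Times case_prod_unfold)
qed

lemma holomorphic_barnes_series:
  assumes a: "a \<in> H" and w: "\<And>i. i \<in> {1..r} \<Longrightarrow> w i \<in> H"
  shows "barnes_series L r w a holomorphic_on {s. real r < Re s}"
proof -
  have "barnes_series L r w a analytic_on {s. real r < Re s}"
    unfolding analytic_on_def
  proof safe
    fix s0 assume s0: "real r < Re s0"
    obtain S A M where M: "open S" "s0 \<in> S" "open A" "a \<in> A" "A \<subseteq> H"
      "M summable_on ({1..r} \<rightarrow>\<^sub>E (UNIV :: nat set))"
      "\<forall>s\<in>S. \<forall>a\<in>A. \<forall>m. norm (log_power L (lattice_point r w a m) (-s)) \<le> M m"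
      by (rule barnes_series_local_majorant[OF a w s0])
    obtain e where e: "e > 0" "cball s0 e \<subseteq> S" using M(1,2) open_contains_cball by blast
    have "barnes_series L r w a holomorphic_on ball s0 e"
    proof (rule holomorphic_uniform_limit)
      show "uniform_limit (cball s0 e) (\<lambda>F s. \<Sum>m\<in>F. log_power L (lattice_point r w a m) (- s)) 
        (barnes_series L r w a) (finite_subsets_at_top ({1..r} \<rightarrow>\<^sub>E UNIV))"
        using M(2,4,6,7) e(2) by (intro barnes_series_tendsto_uniformly[where M = M and g = "\<lambda>_. a" and h = "\<lambda>s. s"]) auto
      show "\<forall>\<^sub>F F in finite_subsets_at_top ({1..r} \<rightarrow>\<^sub>E UNIV). 
         continuous_on (cball s0 e) (\<lambda>s. \<Sum>m\<in>F. log_power L (lattice_point r w a m) (- s)) \<and> 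
         (\<lambda>s. \<Sum>m\<in>F. log_power L (lattice_point r w a m) (- s)) holomorphic_on ball s0 e"
        unfolding log_power_def by (intro always_eventually allI conjI continuous_intros holomorphic_intros)
    qed auto
    then show "\<exists>e>0. barnes_series L r w a holomorphic_on ball s0 e" using e by blast
  qed
  then show ?thesis by (rule analytic_imp_holomorphic)
qed

lemma barnes_series_deriv:
  assumes a: "a \<in> H" and w: "\<And>i. i \<in> {1..r} \<Longrightarrow> w i \<in> H" and s: "real r < Re s"
  shows "((\<lambda>a. barnes_series L r w a s) has_field_derivative - s * barnes_series L r w a (s + 1)) (at a)"
proof -
  let ?I = "{1..r} \<rightarrow>\<^sub>E (UNIV :: nat set)"
  let ?t = "\<lambda>a m s. log_power L (lattice_point r w a m) (- s)"
  obtain S A M where M: "open S" "s \<in> S" "open A" "a \<in> A" "A \<subseteq> H"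
    "M summable_on ({1..r} \<rightarrow>\<^sub>E (UNIV :: nat set))"
    "\<forall>s\<in>S. \<forall>a\<in>A. \<forall>m. norm (log_power L (lattice_point r w a m) (-s)) \<le> M m"
    by (rule barnes_series_local_majorant[OF a w s])
  obtain e where e: "e > 0" "cball a e \<subseteq> A" using M(3,4) open_contains_cball by blast
  have der: "((\<lambda>b. ?t b m s) has_field_derivative - s * ?t b m (s + 1)) (at b)" if "b \<in> H" for b m
  proof -
    have "((\<lambda>b. lattice_point r w b m) has_field_derivative 1) (at b)"
      unfolding lattice_point_def by (auto intro!: derivative_eq_intros)
    from DERIV_chain2[where g = "\<lambda>b. lattice_point r w b m" and x = b,
        OF log_power_deriv[OF lattice_point_in_H[OF that w]] this]
    show ?thesis by simp
  qed
  have lim: "uniform_limit (cball a e) (\<lambda>F b. \<Sum>m\<in>F. ?t b m s) (\<lambda>b. barnes_series L r w b s) (finite_subsets_at_top ?I)"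
    using M(2,4,6,7) e(2) by (intro barnes_series_tendsto_uniformly[where M = M and g = "\<lambda>b. b" and h = "\<lambda>_. s"]) auto
  obtain g' where g': "\<And>b. b \<in> ball a e \<Longrightarrow> ((\<lambda>b. barnes_series L r w b s) has_field_derivative g' b) (at b) \<and>
     ((\<lambda>F. \<Sum>m\<in>F. - s * ?t b m (s + 1)) \<longlongrightarrow> g' b) (finite_subsets_at_top ?I)"
  proof (rule has_complex_derivative_uniform_limit[OF _ lim, of "\<lambda>F b. \<Sum>m\<in>F. - s * ?t b m (s + 1)"])
    have H: "cball a e \<subseteq> H" using e M(5) by auto
    have "((\<lambda>b. \<Sum>m\<in>F. ?t b m s) has_field_derivative (\<Sum>m\<in>F. - s * ?t b m (s + 1))) (at b)" if "b \<in> cball a e" for b F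
      using that H by (intro DERIV_sum der) auto
    then show "\<forall>\<^sub>F F in finite_subsets_at_top ?I. continuous_on (cball a e) (\<lambda>b. \<Sum>m\<in>F. ?t b m s) \<and> 
       (\<forall>b\<in>ball a e. ((\<lambda>b. \<Sum>m\<in>F. ?t b m s) has_field_derivative (\<Sum>m\<in>F. - s * ?t b m (s + 1))) (at b))"
      by (intro always_eventually allI conjI ballI continuous_at_imp_continuous_on) (auto intro: DERIV_isCont)
  qed (use e in auto)
  have "((\<lambda>m. - s * ?t a m (s + 1)) has_sum - s * barnes_series L r w a (s + 1)) ?I"
    unfolding barnes_series_lattice_point 
    using barnes_series_summable[OF a w, where s = "s + 1"] s
    by (intro has_sum_cmult_right has_sum_infsum) auto
  with g'[of a] e have "g' a = - s * barnes_series L r w a (s + 1)"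
    unfolding has_sum_def by (intro tendsto_unique[where F = "finite_subsets_at_top ?I"]) auto
  with g'[of a] e show ?thesis by auto
qed

text \<open>
  Shifting \<open>a\<close> by the last period has the same effect as raising the last index by one, so the
  difference consists of the terms whose last index is zero.
\<close>
lemma barnes_series_difference:
  assumes a: "a \<in> H" and w: "\<And>i. i \<in> {1..Suc r} \<Longrightarrow> w i \<in> H" and s: "real (Suc r) < Re s"
  shows "barnes_series L (Suc r) w a s - barnes_series L (Suc r) w (a + w (Suc r)) s = barnes_series L r w a s"
proof -
  let ?I = "{1..Suc r} \<rightarrow>\<^sub>E (UNIV :: nat set)" and ?J = "{1..r} \<rightarrow>\<^sub>E (UNIV :: nat set)"
  let ?t = "\<lambda>m. log_power L (lattice_point (Suc r) w a m) (- s)"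
  let ?up = "\<lambda>m. m(Suc r := Suc (m (Suc r)))" and ?zero = "\<lambda>m. m(Suc r := (0::nat))"
  have cl: "lattice_point (Suc r) w a (?up m) = lattice_point (Suc r) w (a + w (Suc r)) m"
       "lattice_point (Suc r) w a (?zero m) = lattice_point r w a m" for m
    by (auto simp: lattice_point_def algebra_simps intro!: sum.cong)
  have bij_up: "bij_betw ?up ?I {m \<in> ?I. m (Suc r) \<noteq> 0}"
    by (rule bij_betwI[where g = "\<lambda>m. m(Suc r := m (Suc r) - 1)"]) (auto simp: PiE_iff extensional_def)
  have bij_zero: "bij_betw ?zero ?J {m \<in> ?I. m (Suc r) = 0}"
    by (rule bij_betwI[where g = "\<lambda>m. m(Suc r := undefined)"]) (auto simp: PiE_iff extensional_def fun_eq_iff)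
  have summ: "?t summable_on ?I" using barnes_series_summable[OF a w] s by simp
  have "barnes_series L (Suc r) w a s = infsum ?t ({m \<in> ?I. m (Suc r) = 0} \<union> {m \<in> ?I. m (Suc r) \<noteq> 0})"
    unfolding barnes_series_lattice_point by (intro arg_cong2[where f = infsum]) auto
  also have "\<dots> = infsum ?t {m \<in> ?I. m (Suc r) = 0} + infsum ?t {m \<in> ?I. m (Suc r) \<noteq> 0}"
    by (intro infsum_Un_disjoint summable_on_subset_banach[OF summ]) auto
  also have "infsum ?t {m \<in> ?I. m (Suc r) = 0} = barnes_series L r w a s"
    unfolding barnes_series_lattice_point cl[symmetric] by (rule infsum_reindex_bij_betw[OF bij_zero, symmetric])
  also have "infsum ?t {m \<in> ?I. m (Suc r) \<noteq> 0} = barnes_series L (Suc r) w (a + w (Suc r)) s"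
    unfolding barnes_series_lattice_point cl[symmetric] by (rule infsum_reindex_bij_betw[OF bij_up, symmetric])
  finally show ?thesis by simp
qed

end

section \<open>Analytic continuation by an integral recursion\<close>

definition pole_poly :: "nat \<Rightarrow> complex \<Rightarrow> complex" where
  "pole_poly r s = (\<Prod>i=1..r. s - of_nat i)"

lemma pole_poly_0 [simp]: "pole_poly 0 s = 1"
  by (simp add: pole_poly_def)

lemma pole_poly_Suc: "pole_poly (Suc r) s = pole_poly r s * (s - of_nat (Suc r))"
  by (simp add: pole_poly_def)

lemma pole_poly_Suc_shift: "pole_poly (Suc r) s = (s - 1) * pole_poly r (s - 1)"
proof (induction r)
  case (Suc r)
  show ?case unfolding pole_poly_Suc[of "Suc r"] Suc.IH by (simp add: pole_poly_Suc)
qed (simp add: pole_poly_def)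

text \<open>
  This is the identity that turns the factor \<open>-s\<close> in \<open>\<partial>\<zeta>\<^sub>r(s, a)/\<partial>a = -s \<zeta>\<^sub>r(s + 1, a)\<close> into \<open>r - s\<close> for
  \<open>P\<^sub>r \<zeta>\<^sub>r\<close>, and so removes all denominators from the continuation.
\<close>
lemma pole_poly_shift: "(s - of_nat r) * pole_poly r (s + 1) = s * pole_poly r s"
  using pole_poly_Suc_shift[of r "s + 1"] pole_poly_Suc[of r "s + 1"]
  by (cases r) (simp_all add: pole_poly_Suc algebra_simps)

lemma pole_poly_nonzero_iff: "pole_poly r s \<noteq> 0 \<longleftrightarrow> (\<forall>i\<in>{1..r}. s \<noteq> of_nat i)"
  by (auto simp: pole_poly_def)

lemma holomorphic_pole_poly [holomorphic_intros]: 
  "f holomorphic_on A \<Longrightarrow> (\<lambda>s. pole_poly r (f s)) holomorphic_on A"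
  unfolding pole_poly_def by (intro holomorphic_intros)

lemma continuous_pole_poly [continuous_intros]: 
  "continuous_on A f \<Longrightarrow> continuous_on A (\<lambda>s. pole_poly r (f s))"
  unfolding pole_poly_def by (intro continuous_intros)

text \<open>
  The \<open>j\<close>-fold iterate of \<open>pole_poly_shift\<close>, which brings in the rising factorial \<open>(s)\<^sub>j\<close>.
\<close>
lemma pole_poly_shift_pochhammer:
  "pole_poly r (s + of_nat j) * (\<Prod>i<j. of_nat r - (s + of_nat i)) = (-1) ^ j * pochhammer s j * pole_poly r s"
proof (induction j)
  case (Suc j)
  have *: "pole_poly r (s + of_nat (Suc j)) * (of_nat r - (s + of_nat j)) = - (s + of_nat j) * pole_poly r (s + of_nat j)"
    using pole_poly_shift[of "s + of_nat j" r] by (simp add: algebra_simps)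
  have "pole_poly r (s + of_nat (Suc j)) * (\<Prod>i<Suc j. of_nat r - (s + of_nat i)) =
     pole_poly r (s + of_nat (Suc j)) * (of_nat r - (s + of_nat j)) * (\<Prod>i<j. of_nat r - (s + of_nat i))"
    by (simp add: mult_ac)
  also have "\<dots> = - (s + of_nat j) * (pole_poly r (s + of_nat j) * (\<Prod>i<j. of_nat r - (s + of_nat i)))"
    unfolding * by (simp only: mult.assoc)
  also have "\<dots> = (-1) ^ Suc j * pochhammer s (Suc j) * pole_poly r s"
    unfolding Suc.IH by (simp add: pochhammer_Suc algebra_simps)
  finally show ?case .
qed simp

lemma pole_poly_nonzero_ball: "norm s < 1 \<Longrightarrow> pole_poly r s \<noteq> 0"
  unfolding pole_poly_nonzero_iff
proof
  fix i assume "norm s < 1" "i \<in> {1..r}"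
  then show "s \<noteq> of_nat i" by auto
qed

context log_on_halfplane
begin

text \<open>
  What the continuation has to preserve. The last clause links the values at \<open>s\<close> and \<open>s + 1\<close>, as it must
  for \<open>G = P\<^sub>r \<zeta>\<^sub>r\<close>; holomorphy in \<open>a\<close> is part of it.
\<close>
definition zeta_ladder :: "nat \<Rightarrow> complex set \<Rightarrow> (complex \<Rightarrow> complex \<Rightarrow> complex) \<Rightarrow> bool" where
  "zeta_ladder r S G \<longleftrightarrow> continuous_on (S \<times> H) (\<lambda>(s, a). G s a) \<and>
     (\<forall>a\<in>H. (\<lambda>s. G s a) holomorphic_on S) \<and>
     (\<forall>s\<in>S. \<forall>a\<in>H. (G s has_field_derivative (of_nat r - s) * G (s + 1) a) (at a))"

lemma zeta_ladderD:
  assumes "zeta_ladder r S G"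
  shows "continuous_on (S \<times> H) (\<lambda>(s, a). G s a)"
    and "a \<in> H \<Longrightarrow> (\<lambda>s. G s a) holomorphic_on S"
    and "s \<in> S \<Longrightarrow> a \<in> H \<Longrightarrow> (G s has_field_derivative (of_nat r - s) * G (s + 1) a) (at a)"
  using assms by (auto simp: zeta_ladder_def)

lemma zeta_ladder_subset: "zeta_ladder r S G \<Longrightarrow> T \<subseteq> S \<Longrightarrow> zeta_ladder r T G"
  unfolding zeta_ladder_def by (blast intro: continuous_on_subset holomorphic_on_subset)

lemma zeta_ladder_barnes_series:
  assumes w: "\<And>i. i \<in> {1..r} \<Longrightarrow> w i \<in> H"
  shows "zeta_ladder r {s. real r < Re s} (\<lambda>s a. pole_poly r s * barnes_series L r w a s)"
  unfolding zeta_ladder_def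
proof (intro conjI ballI)
  show "continuous_on ({s. real r < Re s} \<times> H) (\<lambda>(s, a). pole_poly r s * barnes_series L r w a s)"
    using continuous_on_barnes_series[OF w] unfolding case_prod_unfold
    by (intro continuous_intros)
  show "(\<lambda>s. pole_poly r s * barnes_series L r w a s) holomorphic_on {s. real r < Re s}" if "a \<in> H" for a
    using holomorphic_barnes_series[OF that w] by (intro holomorphic_intros)
  fix s a assume s: "s \<in> {s. real r < Re s}" and a: "a \<in> H"
  have "(of_nat r - s) * pole_poly r (s + 1) = - s * pole_poly r s"
    using pole_poly_shift[of s r] by (simp add: algebra_simps)
  then have "(of_nat r - s) * (pole_poly r (s + 1) * barnes_series L r w a (s + 1)) =
      pole_poly r s * (- s * barnes_series L r w a (s + 1))"
    by (simp add: mult.assoc[symmetric])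
  then show "((\<lambda>a. pole_poly r s * barnes_series L r w a s) has_field_derivative 
     (of_nat r - s) * (pole_poly r (s + 1) * barnes_series L r w a (s + 1))) (at a)"
    using DERIV_cmult[OF barnes_series_deriv[where s = s, OF a w], where c = "pole_poly r s"] s by simp
qed

lemma H_segment: "a \<in> H \<Longrightarrow> w \<in> H \<Longrightarrow> t \<in> {0..1} \<Longrightarrow> a + of_real t * w \<in> H"
  by (auto intro: H_ray)

text \<open>
  The integral part of the recursion; the weight \<open>1 - t\<close> comes from integrating by parts
  along the segment from \<open>a\<close> to \<open>a + w\<close>.
\<close>
definition weighted_mean :: "complex \<Rightarrow> (complex \<Rightarrow> complex \<Rightarrow> complex) \<Rightarrow> complex \<Rightarrow> complex \<Rightarrow> complex" where
  "weighted_mean w G s a = integral {0..1} (\<lambda>t. (1 - of_real t) * G s (a + of_real t * w))"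

lemma weighted_mean_cong:
  assumes "a \<in> H" "w \<in> H" "\<And>b. b \<in> H \<Longrightarrow> G s b = G' s b"
  shows "weighted_mean w G s a = weighted_mean w G' s a"
  unfolding weighted_mean_def using assms H_segment by (intro integral_cong) auto

lemma zeta_ladder_weighted_mean:
  assumes G: "zeta_ladder r S G" and S: "open S" "\<And>s. s \<in> S \<Longrightarrow> s + 1 \<in> S" and w: "w \<in> H"
  shows "zeta_ladder r S (weighted_mean w G)"
proof -
  note cont = zeta_ladderD(1)[OF G, unfolded case_prod_unfold]
  have cont': "continuous_on X (\<lambda>x. (1 - of_real (h x)) * G (f x) (g x + of_real (h x) * w))"
    if "continuous_on X f" "continuous_on X g" "continuous_on X h" 
      "\<And>x. x \<in> X \<Longrightarrow> f x \<in> S \<and> g x \<in> H \<and> h x \<in> {0..1}" for X :: "'b::topological_space set" and f g h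
  proof -
    have "continuous_on X (\<lambda>x. G (f x) (g x + of_real (h x) * w))"
      using continuous_on_compose2[OF cont, of X "\<lambda>x. (f x, g x + of_real (h x) * w)"] that H_segment[OF _ w]
      by (force intro!: continuous_intros)
    with that show ?thesis by (intro continuous_intros)
  qed
  show ?thesis
    unfolding zeta_ladder_def
  proof (intro conjI ballI)
    have "continuous_on ((S \<times> H) \<times> {0..1}) (\<lambda>(x, t). (1 - of_real t) * G (fst x) (snd x + of_real t * w))"
      unfolding case_prod_unfold by (rule cont') (auto intro!: continuous_intros)
    with integral_continuous_on_param[of "S \<times> H" 0 1 "\<lambda>x t. (1 - of_real t) * G (fst x) (snd x + of_real t * w)"]
    show "continuous_on (S \<times> H) (\<lambda>(s, a). weighted_mean w G s a)"
      by (simp add: weighted_mean_def case_prod_unfold)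
    show "(\<lambda>s. weighted_mean w G s a) holomorphic_on S" if a: "a \<in> H" for a
      unfolding weighted_mean_def
    proof (rule holomorphic_on_integral_param)
      show "continuous_on (S \<times> {0..1}) (\<lambda>(s, t). (1 - of_real t) * G s (a + of_real t * w))"
        unfolding case_prod_unfold using a by (intro cont') (auto intro!: continuous_intros)
      show "(\<lambda>s. (1 - of_real t) * G s (a + of_real t * w)) holomorphic_on S" if "t \<in> {0..1}" for t
        using zeta_ladderD(2)[OF G H_segment[OF a w that]] by (intro holomorphic_intros)
    qed (rule S)
    fix s a assume s: "s \<in> S" and a: "a \<in> H"
    have "((\<lambda>a. integral (cbox 0 1) (\<lambda>t. (1 - of_real t) * G s (a + of_real t * w))) has_field_derivative
       integral (cbox 0 1) (\<lambda>t. (of_nat r - s) * ((1 - of_real t) * G (s + 1) (a + of_real t * w)))) (at a within H)"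
    proof (rule leibniz_rule_field_derivative)
      fix a t assume a: "a \<in> H" and t: "t \<in> cbox 0 (1::real)"
      have "(G s has_field_derivative (of_nat r - s) * G (s + 1) (a + of_real t * w)) (at (a + of_real t * w))"
        using zeta_ladderD(3)[OF G s H_segment[OF a w]] t by simp
      moreover have "((\<lambda>a. a + of_real t * w) has_field_derivative 1) (at a)"
        by (auto intro!: derivative_eq_intros)
      ultimately have "((\<lambda>a. (1 - of_real t) * G s (a + of_real t * w)) has_field_derivative
        (1 - of_real t) * ((of_nat r - s) * G (s + 1) (a + of_real t * w) * 1)) (at a)"
        by (intro DERIV_cmult DERIV_chain2[where g = "\<lambda>a. a + of_real t * w"])
      then show "((\<lambda>a. (1 - of_real t) * G s (a + of_real t * w)) has_field_derivative
        (of_nat r - s) * ((1 - of_real t) * G (s + 1) (a + of_real t * w))) (at a within H)"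
        by (simp add: has_field_derivative_at_within algebra_simps)
    next
      fix a assume "a \<in> H"
      then show "(\<lambda>t. (1 - of_real t) * G s (a + of_real t * w)) integrable_on cbox 0 1"
        using s by (intro integrable_continuous cont') (auto intro!: continuous_intros)
    next
      have "continuous_on (H \<times> {0..1}) (\<lambda>x. (1 - of_real (snd x)) * G (s + 1) (fst x + of_real (snd x) * w))"
        using S(2)[OF s] by (intro cont') (auto intro!: continuous_intros)
      then show "continuous_on (H \<times> cbox 0 1) (\<lambda>(a, t). (of_nat r - s) * ((1 - of_real t) * G (s + 1) (a + of_real t * w)))"
        by (auto simp: case_prod_unfold intro!: continuous_intros)
    qed (use a convex_H in auto)
    then show "(weighted_mean w G s has_field_derivative (of_nat r - s) * weighted_mean w G (s + 1) a) (at a)"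
      using at_within_open[OF a open_H] unfolding weighted_mean_def[abs_def] by simp
  qed
qed

text \<open>
  \<open>F\<close> stands for \<open>G\<^sub>r\<^sub>-\<^sub>1\<close> and \<open>G\<close> for \<open>G\<^sub>r\<close>. The value at \<open>s\<close> uses \<open>G\<close> only at \<open>s + 1\<close>.
\<close>
definition recursion_rhs where
  "recursion_rhs r w F G s a = F (s - 1) a / w + w * (s - of_nat r) * weighted_mean w G (s + 1) a"

text \<open>
  One step of the continuation. The differential relation is reproduced because both summands pick up
  the same factor: \<open>F\<close> at \<open>s - 1\<close> gives \<open>r - (s - 1)\<close>, which is \<open>Suc r - s\<close>, and in the second summand the
  factors \<open>s - Suc r\<close> and \<open>Suc r - (s + 1)\<close> exchange their roles up to sign.
\<close>
lemma zeta_ladder_recursion_rhs: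
  assumes F: "zeta_ladder r UNIV F" and G: "zeta_ladder (Suc r) {s. c + 1 < Re s} G" and w: "w \<in> H"
  shows "zeta_ladder (Suc r) {s. c < Re s} (recursion_rhs (Suc r) w F G)"
proof -
  have M: "zeta_ladder (Suc r) {s. c + 1 < Re s} (weighted_mean w G)"
    using zeta_ladder_weighted_mean[OF G _ _ w] by (auto intro: open_halfspace_Re_gt)
  show ?thesis
    unfolding zeta_ladder_def recursion_rhs_def[abs_def]
  proof (intro conjI ballI)
    have "continuous_on ({s. c < Re s} \<times> H) (\<lambda>x. F (fst x - 1) (snd x))"
      using continuous_on_compose2[OF zeta_ladderD(1)[OF F, unfolded case_prod_unfold], of "{s. c < Re s} \<times> H" "\<lambda>x. (fst x - 1, snd x)"]
      by (force intro!: continuous_intros)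
    moreover have "continuous_on ({s. c < Re s} \<times> H) (\<lambda>x. weighted_mean w G (fst x + 1) (snd x))"
      using continuous_on_compose2[OF zeta_ladderD(1)[OF M, unfolded case_prod_unfold], of "{s. c < Re s} \<times> H" "\<lambda>x. (fst x + 1, snd x)"]
      by (force intro!: continuous_intros)
    ultimately show "continuous_on ({s. c < Re s} \<times> H) (\<lambda>(s, a). F (s - 1) a / w + 
        w * (s - of_nat (Suc r)) * weighted_mean w G (s + 1) a)"
      unfolding case_prod_unfold using nonzero_H[OF w] by (intro continuous_intros) auto
    show "(\<lambda>s. F (s - 1) a / w + w * (s - of_nat (Suc r)) * weighted_mean w G (s + 1) a) holomorphic_on {s. c < Re s}"
      if a: "a \<in> H" for a
    proof -
      have "(\<lambda>s. F (s - 1) a) holomorphic_on {s. c < Re s}"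
        using holomorphic_on_compose[of "\<lambda>s. s - 1" "{s. c < Re s}" "\<lambda>s. F s a"] 
           holomorphic_on_subset[OF zeta_ladderD(2)[OF F a]] by (simp add: o_def holomorphic_intros)
      moreover have "(\<lambda>s. weighted_mean w G (s + 1) a) holomorphic_on {s. c < Re s}"
        using holomorphic_on_compose[of "\<lambda>s. s + 1" "{s. c < Re s}" "\<lambda>s. weighted_mean w G s a"] 
          holomorphic_on_subset[OF zeta_ladderD(2)[OF M a], of "(\<lambda>s. s + 1) ` {s. c < Re s}"] 
        by (force simp: o_def intro: holomorphic_intros)
      ultimately show ?thesis using nonzero_H[OF w] by (intro holomorphic_intros) auto
    qed
    fix s a assume s: "s \<in> {s. c < Re s}" and a: "a \<in> H"
    have "((\<lambda>a. F (s - 1) a / w + w * (s - of_nat (Suc r)) * weighted_mean w G (s + 1) a) has_field_derivative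
        (of_nat r - (s - 1)) * F (s - 1 + 1) a / w + 
         w * (s - of_nat (Suc r)) * ((of_nat (Suc r) - (s + 1)) * weighted_mean w G (s + 1 + 1) a)) (at a)"
      using s by (intro DERIV_add DERIV_cdivide DERIV_cmult zeta_ladderD(3)[OF F] zeta_ladderD(3)[OF M] a) auto
    then show "((\<lambda>a. F (s - 1) a / w + w * (s - of_nat (Suc r)) * weighted_mean w G (s + 1) a) has_field_derivative
       (of_nat (Suc r) - s) * (F (s + 1 - 1) a / w + w * (s + 1 - of_nat (Suc r)) * weighted_mean w G (s + 1 + 1) a)) (at a)"
      by (rule DERIV_cong) (simp add: algebra_simps add_divide_distrib diff_divide_distrib)
  qed
qed

text \<open>
  The function \<open>g\<close> in the proof combines \<open>(1 - t) \<zeta>(s, a + t w)\<close> with an antiderivative of \<open>\<zeta>(s, a + t w)\<close>,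
  so that in \<open>g'\<close> only the integrand of the recursion is left. The antiderivative is a multiple of \<open>\<zeta>\<close> at
  \<open>s - 1\<close>, whence the series must converge there and \<open>Re s\<close> must exceed \<open>Suc r + 1\<close>. The boundary values at
  \<open>s - 1\<close> differ by one period and collapse to the series with one summation variable fewer.
\<close>
lemma barnes_series_recursion:
  assumes a: "a \<in> H" and w: "\<And>i. i \<in> {1..Suc r} \<Longrightarrow> w i \<in> H" and s: "real (Suc r) + 1 < Re s"
  shows "pole_poly (Suc r) s * barnes_series L (Suc r) w a s = 
    recursion_rhs (Suc r) (w (Suc r)) (\<lambda>s a. pole_poly r s * barnes_series L r w a s) 
       (\<lambda>s a. pole_poly (Suc r) s * barnes_series L (Suc r) w a s) s a"
proof -
  let ?Z = "\<lambda>s a. barnes_series L (Suc r) w a s" and ?w = "w (Suc r)"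
  have wH: "?w \<in> H" using w by simp
  have nz: "?w \<noteq> 0" "s - 1 \<noteq> 0" using nonzero_H[OF wH] s by auto
  define g where "g t = (1 - of_real t) * ?Z s (a + of_real t * ?w) - ?Z (s - 1) (a + of_real t * ?w) / ((s - 1) * ?w)" 
    for t :: real
  have der: "((\<lambda>t. ?Z z (a + of_real t * ?w)) has_vector_derivative - z * ?Z (z + 1) (a + of_real t * ?w) * ?w) (at t within {0..1})"
    if t: "t \<in> {0..1}" and z: "real (Suc r) < Re z" for t z
  proof -
    have "((\<lambda>t. a + t * ?w) has_field_derivative ?w) (at (of_real t))"
      by (auto intro!: derivative_eq_intros)
    with barnes_series_deriv[OF H_segment[OF a wH t] w z]
    have "((\<lambda>t. ?Z z (a + t * ?w)) has_field_derivative - z * ?Z (z + 1) (a + of_real t * ?w) * ?w) (at (of_real t))"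
      by (intro DERIV_chain2[where g = "\<lambda>t. a + t * ?w"])
    then show ?thesis by (rule has_vector_derivative_real_field)
  qed
  have "(g has_vector_derivative - s * ?w * ((1 - of_real t) * ?Z (s + 1) (a + of_real t * ?w))) (at t within {0..1})" 
    if t: "t \<in> {0..1}" for t
  proof -
    have 1: "((\<lambda>t. 1 - complex_of_real t) has_vector_derivative -1) (at t within {0..1})"
      by (auto intro!: derivative_eq_intros simp: has_vector_derivative_def has_derivative_of_real)
         (auto intro!: derivative_eq_intros simp: scaleR_conv_of_real)
    have "(g has_vector_derivative 
       ((1 - of_real t) * (- s * ?Z (s + 1) (a + of_real t * ?w) * ?w) + (-1) * ?Z s (a + of_real t * ?w)) -
        (- (s - 1) * ?Z (s - 1 + 1) (a + of_real t * ?w) * ?w) / ((s - 1) * ?w)) (at t within {0..1})"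
      unfolding g_def using s
      by (intro has_vector_derivative_diff has_vector_derivative_mult has_vector_derivative_divide 1 der t) auto
    then show ?thesis
      by (rule has_vector_derivative_eq_rhs) (use nz in \<open>simp add: field_simps\<close>)
  qed
  then have "((\<lambda>t. - s * ?w * ((1 - of_real t) * ?Z (s + 1) (a + of_real t * ?w))) has_integral g 1 - g 0) {0..1}"
    by (intro fundamental_theorem_of_calculus) auto
  then have "- s * ?w * weighted_mean ?w ?Z (s + 1) a = g 1 - g 0"
    unfolding weighted_mean_def by (subst integral_mult_right[symmetric]) (rule integral_unique)
  also have "g 1 - g 0 = (?Z (s - 1) a - ?Z (s - 1) (a + ?w)) / ((s - 1) * ?w) - ?Z s a"
    by (simp add: g_def diff_divide_distrib)
  also have "?Z (s - 1) a - ?Z (s - 1) (a + ?w) = barnes_series L r w a (s - 1)"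
    using barnes_series_difference[OF a w, where s = "s - 1"] s by simp
  finally have Z: "?Z s a = barnes_series L r w a (s - 1) / ((s - 1) * ?w) + s * ?w * weighted_mean ?w ?Z (s + 1) a"
    by (simp add: algebra_simps)
  have mean: "weighted_mean ?w (\<lambda>s a. pole_poly (Suc r) s * ?Z s a) (s + 1) a = 
      pole_poly (Suc r) (s + 1) * weighted_mean ?w ?Z (s + 1) a"
    unfolding weighted_mean_def by (subst integral_mult_right[symmetric]) (simp add: mult_ac)
  have "pole_poly (Suc r) s * ?Z s a = pole_poly (Suc r) s / (s - 1) * barnes_series L r w a (s - 1) / ?w +
      ?w * (s * pole_poly (Suc r) s) * weighted_mean ?w ?Z (s + 1) a"
    by (simp add: Z distrib_left mult_ac)
  also have "pole_poly (Suc r) s / (s - 1) = pole_poly r (s - 1)"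
    using nz by (simp add: pole_poly_Suc_shift)
  also have "s * pole_poly (Suc r) s = (s - of_nat (Suc r)) * pole_poly (Suc r) (s + 1)"
    by (simp only: pole_poly_shift)
  finally show ?thesis by (simp only: recursion_rhs_def mean mult.assoc)
qed

lemma zeta_ladder_log_power: "zeta_ladder 0 UNIV (\<lambda>s a. log_power L a (-s))"
  unfolding zeta_ladder_def
proof (intro conjI ballI)
  show "continuous_on (UNIV \<times> H) (\<lambda>(s, a). log_power L a (-s))"
    unfolding case_prod_unfold log_power_def 
    by (intro continuous_intros continuous_on_compose2[OF continuous_L]) auto
  show "(\<lambda>s. log_power L a (-s)) holomorphic_on UNIV" for a
    unfolding log_power_def by (intro holomorphic_intros)
  show "((\<lambda>a. log_power L a (-s)) has_field_derivative (of_nat 0 - s) * log_power L a (-(s + 1))) (at a)" if "a \<in> H" for s a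
    using log_power_deriv[OF that] by simp
qed

lemma barnes_series_0: "barnes_series L 0 w a s = log_power L a (-s)"
  by (simp add: barnes_series_def)

text \<open>
  The half-planes \<open>Re s > c - N\<close> exhaust the plane, and all conditions of a ladder are local in \<open>s\<close>
  except the link between \<open>s\<close> and \<open>s + 1\<close>, which never leaves a right half-plane.
\<close>
lemma zeta_ladder_glue:
  assumes ladder: "\<And>N. zeta_ladder r {s. c - real N < Re s} (Gs N)"
    and stable: "\<And>N s a. c - real N < Re s \<Longrightarrow> a \<in> H \<Longrightarrow> Gs (Suc N) s a = Gs N s a"
  obtains G where "zeta_ladder r UNIV G" 
    "\<forall>N s a. c - real N < Re s \<longrightarrow> a \<in> H \<longrightarrow> G s a = Gs N s a"
proof -
  define n where "n s = nat (\<lceil>c - Re s\<rceil> + 1)" for s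
  define G where "G s = Gs (n s) s" for s
  have n: "c - real (n s) < Re s" for s unfolding n_def by linarith
  have le: "Gs M s a = Gs N s a" if "N \<le> M" "c - real N < Re s" "a \<in> H" for M N s a
    using that(1)
  proof (induction rule: dec_induct)
    case (step M)
    then have "c - real M < Re s" using that(2) by linarith
    with step that(3) stable show ?case by simp
  qed simp
  have G: "G s a = Gs N s a" if "c - real N < Re s" "a \<in> H" for N s a
    using le[of N "n s" s a] le[of "n s" N s a] that n[of s] unfolding G_def by (metis nat_le_linear)
  have "zeta_ladder r UNIV G"
    unfolding zeta_ladder_def
  proof (intro conjI ballI)
    show "continuous_on (UNIV \<times> H) (\<lambda>(s, a). G s a)"
    proof (rule continuous_at_imp_continuous_on, safe)
      fix s a assume a: "a \<in> H"
      let ?U = "{z. c - real (n s) < Re z} \<times> H"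
      have U: "open ?U" by (intro open_Times open_H open_halfspace_Re_gt)
      have "continuous_on ?U (\<lambda>(s, a). G s a)"
        by (rule continuous_on_eq[OF zeta_ladderD(1)[OF ladder]]) (auto simp: G)
      then show "isCont (\<lambda>(s, a). G s a) (s, a)"
        using U n[of s] a by (simp add: continuous_on_eq_continuous_at)
    qed
    fix a assume a: "a \<in> H"
    have "(\<lambda>s. G s a) analytic_on UNIV"
      unfolding analytic_on_def
    proof
      fix s
      have op: "open {z. c - real (n s) < Re z}" by (rule open_halfspace_Re_gt)
      then obtain e where e: "e > 0" "ball s e \<subseteq> {z. c - real (n s) < Re z}"
        using n[of s] openE by blast
      have "(\<lambda>z. G z a) holomorphic_on {z. c - real (n s) < Re z}"
        by (rule holomorphic_transform[OF zeta_ladderD(2)[OF ladder a]]) (auto simp: G a)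
      with e show "\<exists>e>0. (\<lambda>s. G s a) holomorphic_on ball s e"
        using holomorphic_on_subset by blast
    qed
    then show "(\<lambda>s. G s a) holomorphic_on UNIV" by (rule analytic_imp_holomorphic)
  next
    fix s a assume a: "a \<in> H"
    have s1: "c - real (n s) < Re (s + 1)" using n[of s] by simp
    have "(Gs (n s) s has_field_derivative (of_nat r - s) * G (s + 1) a) (at a)"
      using zeta_ladderD(3)[OF ladder _ a, of s "n s"] n[of s] G[OF s1 a] by simp
    then show "(G s has_field_derivative (of_nat r - s) * G (s + 1) a) (at a)"
      by (simp add: G_def)
  qed
  with G that show thesis by blast
qed

text \<open>
  Induction on \<open>r\<close>, and for each \<open>r\<close> iteration of the recursion from the series on \<open>Re s > r + 1\<close>. The
  iterates agree where they overlap because the series itself satisfies the recursion. The identity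
  theorem recovers the series on the remaining strip \<open>r < Re s \<le> r + 1\<close>.
\<close>
theorem barnes_continuation:
  assumes "\<And>i. i \<in> {1..r} \<Longrightarrow> w i \<in> H"
  shows "\<exists>G. zeta_ladder r UNIV G \<and> 
    (\<forall>s a. real r < Re s \<longrightarrow> a \<in> H \<longrightarrow> G s a = pole_poly r s * barnes_series L r w a s)"
  using assms
proof (induction r)
  case 0
  show ?case
    by (intro exI[of _ "\<lambda>s a. log_power L a (-s)"]) (simp add: zeta_ladder_log_power barnes_series_0)
next
  case (Suc r)
  let ?w = "w (Suc r)" and ?c = "real (Suc r) + 1"
  let ?S = "\<lambda>s a. pole_poly (Suc r) s * barnes_series L (Suc r) w a s"
  have wH: "?w \<in> H" using Suc.prems by simp
  obtain F where F: "zeta_ladder r UNIV F" 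
    "\<And>s a. real r < Re s \<Longrightarrow> a \<in> H \<Longrightarrow> F s a = pole_poly r s * barnes_series L r w a s"
    using Suc by force
  define Gs where "Gs N = (recursion_rhs (Suc r) ?w F ^^ N) ?S" for N
  have Gs_0: "Gs 0 = ?S" and Gs_Suc: "Gs (Suc N) = recursion_rhs (Suc r) ?w F (Gs N)" for N
    by (simp_all add: Gs_def)
  have ladder: "zeta_ladder (Suc r) {s. ?c - real N < Re s} (Gs N)" for N
  proof (induction N)
    case 0
    show ?case unfolding Gs_0
      by (rule zeta_ladder_subset[OF zeta_ladder_barnes_series[OF Suc.prems]]) auto
  next
    case (Suc N)
    then have "zeta_ladder (Suc r) {s. (?c - real (Suc N)) + 1 < Re s} (Gs N)" by (simp add: algebra_simps)
    then show ?case unfolding Gs_Suc by (intro zeta_ladder_recursion_rhs F(1) wH)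
  qed
  have stable: "Gs (Suc N) s a = Gs N s a" if "?c - real N < Re s" "a \<in> H" for N s a
    using that
  proof (induction N arbitrary: s a)
    case 0
    then have "F (s - 1) a = pole_poly r (s - 1) * barnes_series L r w a (s - 1)"
      using 0 by (intro F(2)) auto
    with 0 show ?case
      unfolding Gs_Suc unfolding Gs_0 
      using barnes_series_recursion[OF 0(2) Suc.prems, where s = s] by (simp add: recursion_rhs_def)
  next
    case (Suc N)
    have "Gs (Suc N) (s + 1) b = Gs N (s + 1) b" if "b \<in> H" for b
      using Suc.IH[OF _ that, of "s + 1"] Suc.prems(1) by simp
    then have mean: "weighted_mean ?w (Gs (Suc N)) (s + 1) a = weighted_mean ?w (Gs N) (s + 1) a"
      by (rule weighted_mean_cong[OF Suc.prems(2) wH])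
    show ?case
      unfolding Gs_Suc[of "Suc N"] 
      by (subst (2) Gs_Suc) (simp only: recursion_rhs_def mean)
  qed
  obtain G where G: "zeta_ladder (Suc r) UNIV G" 
    "\<forall>N s a. ?c - real N < Re s \<longrightarrow> a \<in> H \<longrightarrow> G s a = Gs N s a"
    by (rule zeta_ladder_glue[OF ladder stable])
  have "G s a = ?S s a" if s: "real (Suc r) < Re s" and a: "a \<in> H" for s a
  proof (rule analytic_continuation_open[of "{s. ?c < Re s}" "{s. real (Suc r) < Re s}" "\<lambda>s. G s a" "\<lambda>s. ?S s a"])
    have "of_real (?c + 1) \<in> {s. ?c < Re s}" by simp
    then show "{s. ?c < Re s} \<noteq> {}" by blast
    show "(\<lambda>s. G s a) holomorphic_on {s. real (Suc r) < Re s}"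
      using zeta_ladderD(2)[OF G(1) a] holomorphic_on_subset by blast
    show "(\<lambda>s. ?S s a) holomorphic_on {s. real (Suc r) < Re s}"
      using zeta_ladderD(2)[OF zeta_ladder_barnes_series[OF Suc.prems] a] .
    show "G z a = ?S z a" if "z \<in> {s. ?c < Re s}" for z
      using G(2)[rule_format, of 0 z a] that a by (simp add: Gs_0)
    show "connected {s. real (Suc r) < Re s}"
      by (intro convex_connected convex_halfspace_Re_gt)
  qed (use s in \<open>auto intro: open_halfspace_Re_gt\<close>)
  with G(1) show ?case by blast
qed

end

section \<open>The continued zeta function\<close>

text \<open>
  Identity theorem for total functions: the difference vanishes off isolated points, and at those points
  a nicely meromorphic function is determined by its values nearby. This is what makes the definite
  description in \<^const>\<open>barnes_zeta\<close> well-defined.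
\<close>
lemma nicely_meromorphic_on_UNIV_unique:
  assumes f: "f nicely_meromorphic_on UNIV" and g: "g nicely_meromorphic_on UNIV"
    and U: "open U" "z0 \<in> U" and eq: "\<And>z. z \<in> U \<Longrightarrow> f z = g z"
  shows "f = g"
proof
  fix z
  define D where "D = remove_sings (\<lambda>z. f z - g z)"
  have mero: "f meromorphic_on UNIV" "g meromorphic_on UNIV"
    using f g by (auto simp: nicely_meromorphic_on_def)
  have fg: "(\<lambda>z. f z - g z) meromorphic_on UNIV"
    using mero by (intro meromorphic_intros)
  have nice: "D nicely_meromorphic_on UNIV"
    unfolding D_def by (rule remove_sings_nicely_meromorphic[OF fg])
  have "D z = 0" if "z \<in> U" for z
  proof -
    have "eventually (\<lambda>x. x \<in> U) (at z)"
      using U(1) that by (intro eventually_at_in_open') auto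
    then have "eventually (\<lambda>x. f x - g x = 0) (at z)"
      by eventually_elim (simp add: eq)
    then have "(\<lambda>x. f x - g x) \<midarrow>z\<rightarrow> 0"
      by (rule tendsto_eventually)
    then show ?thesis unfolding D_def by (rule remove_sings_eqI)
  qed
  then have "frequently (\<lambda>z. D z = 0) (at z0)"
    using U by (intro eventually_frequently eventually_mono[OF eventually_at_in_open'[OF U]]) auto
  then have D0: "D z = 0" for z
    using frequently_eq_meromorphic_imp_constant[OF _ nice, of 0 z0 z] connected_UNIV by simp
  have "isolated_singularity_at (\<lambda>z. f z - g z) z"
    using fg meromorphic_on_isolated_singularity meromorphic_on_meromorphic_at by blast
  from eventually_remove_sings_eq_at[OF this] have "eventually (\<lambda>x. f x = g x) (at z)"
    by eventually_elim (use D0 in \<open>simp add: D_def\<close>)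
  then have "remove_sings f z = remove_sings g z"
    by (rule remove_sings_cong) simp
  moreover have "remove_sings h z = h z" if "h nicely_meromorphic_on UNIV" for h
  proof -
    from that consider "is_pole h z" "h z = 0" | "h \<midarrow>z\<rightarrow> h z"
      unfolding nicely_meromorphic_on_def by blast
    then show ?thesis by cases (auto intro: remove_sings_eqI)
  qed
  ultimately show "f z = g z" using f g by simp
qed

context log_on_halfplane
begin

text \<open>
  The function described in \<^const>\<open>barnes_zeta\<close> is \<open>G/P\<^sub>r\<close> after removal of its removable singularities,
  all of which are zeros of \<open>P\<^sub>r\<close>.
\<close>
lemma barnes_zeta_eq:
  assumes G: "zeta_ladder r UNIV G" 
    and series: "\<And>s. real r < Re s \<Longrightarrow> G s a = pole_poly r s * barnes_series L r w a s"
    and a: "a \<in> H" and s: "pole_poly r s \<noteq> 0"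
  shows "barnes_zeta L r w a s = G s a / pole_poly r s"
proof -
  define f where "f = remove_sings (\<lambda>s. G s a / pole_poly r s)"
  have hol: "(\<lambda>s. G s a) holomorphic_on UNIV" by (rule zeta_ladderD(2)[OF G a])
  have ana: "(\<lambda>s. G s a) analytic_on UNIV" "pole_poly r analytic_on UNIV"
    using hol holomorphic_pole_poly[OF holomorphic_on_ident, where A = UNIV and r = r] by (simp_all add: analytic_on_open)
  have f: "f s = G s a / pole_poly r s" if "pole_poly r s \<noteq> 0" for s
  proof -
    have "(\<lambda>s. G s a / pole_poly r s) analytic_on {s}"
      using that analytic_on_subset[OF ana(1)] analytic_on_subset[OF ana(2)] 
      by (intro analytic_on_divide) auto
    then show ?thesis unfolding f_def by (rule remove_sings_at_analytic)
  qed
  have f_series: "f s = barnes_series L r w a s" if "real r < Re s" for s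
  proof -
    have "pole_poly r s \<noteq> 0" using that by (auto simp: pole_poly_nonzero_iff)
    then show ?thesis using f[of s] series[OF that] by simp
  qed
  have nice: "f nicely_meromorphic_on UNIV"
    unfolding f_def
    by (intro remove_sings_nicely_meromorphic meromorphic_on_divide analytic_on_imp_meromorphic_on ana)
  have "barnes_zeta L r w a = f"
    unfolding barnes_zeta_def
  proof (rule the_equality)
    fix g assume g: "g nicely_meromorphic_on UNIV \<and> (\<forall>s. real r < Re s \<longrightarrow> g s = barnes_series L r w a s)"
    show "g = f"
      by (rule nicely_meromorphic_on_UNIV_unique[where U = "{s. real r < Re s}" and ?z0.0 = "of_real (real r + 1)"]) 
         (use g nice f_series in \<open>auto intro: open_halfspace_Re_gt\<close>)
  qed (use nice f_series in auto)
  with f[OF s] show ?thesis by simp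
qed

text \<open>
  The \<open>j\<close>-th derivative of \<open>\<zeta>\<^sub>r(u, b) = G(u, b)/P\<^sub>r(u)\<close> in \<open>b\<close>, in closed form. Unlike \<open>\<zeta>\<^sub>r(u + j, b)\<close>, which
  may have a pole at \<open>u = 0\<close>, it is holomorphic in \<open>u\<close> on the unit disc.
\<close>
definition ladder_deriv :: "nat \<Rightarrow> (complex \<Rightarrow> complex \<Rightarrow> complex) \<Rightarrow> nat \<Rightarrow> complex \<Rightarrow> complex \<Rightarrow> complex" where
  "ladder_deriv r G j u b = (\<Prod>i<j. of_nat r - (u + of_nat i)) * G (u + of_nat j) b / pole_poly r u"

lemma ladder_deriv_properties:
  assumes G: "zeta_ladder r UNIV G"
  shows "continuous_on (ball 0 1 \<times> H) (\<lambda>(u, b). ladder_deriv r G j u b)"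
    and "b \<in> H \<Longrightarrow> (\<lambda>u. ladder_deriv r G j u b) holomorphic_on ball 0 1"
    and "b \<in> H \<Longrightarrow> (ladder_deriv r G j u has_field_derivative ladder_deriv r G (Suc j) u b) (at b)"
proof -
  have "continuous_on (ball 0 1 \<times> H) (\<lambda>x. G (fst x + of_nat j) (snd x))"
    using continuous_on_compose2[OF zeta_ladderD(1)[OF G, unfolded case_prod_unfold], of "ball 0 1 \<times> H" "\<lambda>x. (fst x + of_nat j, snd x)"]
    by (force intro!: continuous_intros)
  then show "continuous_on (ball 0 1 \<times> H) (\<lambda>(u, b). ladder_deriv r G j u b)"
    unfolding case_prod_unfold ladder_deriv_def
    by (intro continuous_intros) (auto simp: pole_poly_nonzero_ball)
next
  assume b: "b \<in> H"
  have "(\<lambda>u. G (u + of_nat j) b) holomorphic_on ball 0 1"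
    using holomorphic_on_compose[of "\<lambda>u. u + of_nat j" "ball 0 1" "\<lambda>u. G u b"] 
       holomorphic_on_subset[OF zeta_ladderD(2)[OF G b]] by (simp add: o_def holomorphic_intros)
  then show "(\<lambda>u. ladder_deriv r G j u b) holomorphic_on ball 0 1"
    unfolding ladder_deriv_def by (intro holomorphic_intros) (auto simp: pole_poly_nonzero_ball)
  have "((\<lambda>b. (\<Prod>i<j. of_nat r - (u + of_nat i)) * G (u + of_nat j) b / pole_poly r u) has_field_derivative
     (\<Prod>i<j. of_nat r - (u + of_nat i)) * ((of_nat r - (u + of_nat j)) * G (u + of_nat j + 1) b) / pole_poly r u) (at b)"
    by (intro DERIV_cdivide DERIV_cmult zeta_ladderD(3)[OF G] b) auto
  then show "(ladder_deriv r G j u has_field_derivative ladder_deriv r G (Suc j) u b) (at b)"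
    unfolding ladder_deriv_def[abs_def] by (simp add: algebra_simps)
qed

text \<open>
  Exchanging the order of differentiation puts the \<open>a\<close>-derivatives inside, where they are explicit.
\<close>
lemma deriv_a_deriv_s_barnes_zeta:
  assumes G: "zeta_ladder r UNIV G" 
    and series: "\<And>s a. real r < Re s \<Longrightarrow> a \<in> H \<Longrightarrow> G s a = pole_poly r s * barnes_series L r w a s"
    and a: "a \<in> H"
  shows "(deriv ^^ j) (\<lambda>b. (deriv ^^ m) (barnes_zeta L r w b) 0) a = (deriv ^^ m) (\<lambda>u. ladder_deriv r G j u a) 0"
  using a
proof (induction j arbitrary: a)
  case 0
  have "eventually (\<lambda>u::complex. u \<in> ball 0 1) (nhds 0)"
    by (rule eventually_nhds_in_open) auto
  then have "eventually (\<lambda>u. barnes_zeta L r w a u = ladder_deriv r G 0 u a) (nhds 0)"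
    by eventually_elim (use barnes_zeta_eq[OF G series 0] pole_poly_nonzero_ball 0 in \<open>auto simp: ladder_deriv_def\<close>)
  then show ?case by (simp add: higher_deriv_cong_ev)
next
  case (Suc j)
  let ?D = "\<lambda>j b. (deriv ^^ m) (\<lambda>u. ladder_deriv r G j u b) 0"
  have "(?D j has_field_derivative ?D (Suc j) a) (at a)"
    by (rule higher_deriv_param_deriv[OF open_H convex_H Suc.prems, of 1])
       (use ladder_deriv_properties[OF G] in auto)
  then have "((deriv ^^ j) (\<lambda>b. (deriv ^^ m) (barnes_zeta L r w b) 0) has_field_derivative ?D (Suc j) a) (at a)"
    by (rule has_field_derivative_transform_within_open[OF _ open_H Suc.prems]) (simp add: Suc.IH)
  then show ?case by (simp add: DERIV_imp_deriv)
qed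

text \<open>
  The iterated relation \<open>\<partial>\<^sup>j\<zeta>\<^sub>r(u, a)/\<partial>a\<^sup>j = (-1)\<^sup>j (u)\<^sub>j \<zeta>\<^sub>r(u + j, a)\<close>, solved for \<open>\<zeta>\<^sub>r(u + j, a)\<close>. On the
  punctured unit disc \<open>u\<close> is not an integer, so nothing vanishes in the denominators.
\<close>
lemma barnes_zeta_shift:
  assumes G: "zeta_ladder r UNIV G" 
    and series: "\<And>s a. real r < Re s \<Longrightarrow> a \<in> H \<Longrightarrow> G s a = pole_poly r s * barnes_series L r w a s"
    and a: "a \<in> H" and u: "0 < norm u" "norm u < 1" 
  shows "barnes_zeta L r w a (of_nat j + u) = (-1) ^ j * ladder_deriv r G j u a / pochhammer u j"
proof -
  have nonint: "u + of_nat i \<noteq> of_nat i'" for i i'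
  proof
    assume "u + of_nat i = of_nat i'"
    then have "u = of_int (int i' - int i)" by (simp add: algebra_simps)
    with u have "0 < \<bar>real_of_int (int i' - int i)\<bar>" "\<bar>real_of_int (int i' - int i)\<bar> < 1"
      by (simp_all only: norm_of_int)
    then have "0 < \<bar>int i' - int i\<bar>" "\<bar>int i' - int i\<bar> < 1"
      by (simp_all only: of_int_abs[symmetric] of_int_0_less_iff of_int_less_1_iff)
    then show False by linarith
  qed
  have P: "pole_poly r (u + of_nat j) \<noteq> 0" unfolding pole_poly_nonzero_iff using nonint by blast
  have P0: "pole_poly r u \<noteq> 0" by (rule pole_poly_nonzero_ball) fact
  have poch: "pochhammer u j \<noteq> 0"
    using nonint[of _ 0] by (simp add: pochhammer_prod)
  have "barnes_zeta L r w a (of_nat j + u) = G (u + of_nat j) a / pole_poly r (u + of_nat j)"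
    using barnes_zeta_eq[OF G series a P] a by (simp add: add.commute)
  also have "\<dots> = (-1) ^ j * ladder_deriv r G j u a / pochhammer u j"
  proof -
    have "(-1) ^ j * (\<Prod>i<j. of_nat r - (u + of_nat i)) * pole_poly r (u + of_nat j) = pochhammer u j * pole_poly r u"
      using pole_poly_shift_pochhammer[of r u j] by (simp add: mult_ac flip: power_mult_distrib)
    then have "(-1) ^ j * (\<Prod>i<j. of_nat r - (u + of_nat i)) = pochhammer u j * pole_poly r u / pole_poly r (u + of_nat j)"
      using P by (simp add: field_simps)
    moreover have "(-1) ^ j * ladder_deriv r G j u a = 
       (-1) ^ j * (\<Prod>i<j. of_nat r - (u + of_nat i)) * G (u + of_nat j) a / pole_poly r u"
      unfolding ladder_deriv_def by (simp only: mult.assoc times_divide_eq_right)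
    ultimately have "(-1) ^ j * ladder_deriv r G j u a = 
       pochhammer u j * pole_poly r u / pole_poly r (u + of_nat j) * G (u + of_nat j) a / pole_poly r u"
      by (simp only:)
    then show ?thesis using P0 poch by simp
  qed
  finally show ?thesis .
qed

end

section \<open>Laurent coefficients at the poles\<close>

text \<open>
  Multiplication by \<open>s\<close> turns a Laurent series with at most a simple pole into a power series. The value
  at \<open>s = 0\<close> has to be prescribed, since \<open>s f(s)\<close> is \<open>0\<close> there whatever the residue \<open>d\<^sub>-\<^sub>1\<close>.
\<close>
lemma has_fps_expansion_of_has_sum_shift:
  fixes f :: "complex \<Rightarrow> complex" and d :: "int \<Rightarrow> complex"
  assumes "\<And>s. 0 < norm s \<Longrightarrow> norm s < 1 \<Longrightarrow> ((\<lambda>n. d n * s powi n) has_sum f s) {-1..}"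
  shows "(\<lambda>s. if s = 0 then d (-1) else s * f s) has_fps_expansion Abs_fps (\<lambda>n. d (int n - 1))"
proof (rule has_fps_expansionI)
  have "eventually (\<lambda>s::complex. s \<in> ball 0 1) (nhds 0)"
    by (rule eventually_nhds_in_open) auto
  then show "eventually (\<lambda>s. (\<lambda>n. fps_nth (Abs_fps (\<lambda>n. d (int n - 1))) n * s ^ n) sums 
      (if s = 0 then d (-1) else s * f s)) (nhds 0)"
  proof eventually_elim
    case (elim s)
    show ?case
    proof (cases "s = 0")
      case True
      then show ?thesis using powser_sums_zero[of "\<lambda>n. d (int n - 1)"] by simp
    next
      case False
      with elim have "((\<lambda>n. s * (d n * s powi n)) has_sum s * f s) {-1..}"
        by (intro has_sum_cmult_right assms) auto
      moreover have bij: "bij_betw (\<lambda>n. int n - 1) UNIV {-1..}"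
        by (rule bij_betwI[where g = "\<lambda>n. nat (n + 1)"]) auto
      ultimately have "((\<lambda>n. s * (d (int n - 1) * s powi (int n - 1))) has_sum s * f s) UNIV"
        using has_sum_reindex_bij_betw[OF bij, of "\<lambda>n. s * (d n * s powi n)"] by simp
      moreover have "s * (d (int n - 1) * s powi (int n - 1)) = d (int n - 1) * s ^ n" for n
        using False by (simp add: power_int_diff)
      ultimately show ?thesis using False by (simp add: has_sum_imp_sums)
    qed
  qed
qed

context log_on_halfplane
begin

text \<open>
  Near \<open>s = 0\<close>, \<open>s \<zeta>\<^sub>r(j + s, a)\<close> is \<open>(-1)\<^sup>j\<close> times the product of two power series: \<open>C\<close>, the Taylor series of
  the \<open>j\<close>-th \<open>a\<close>-derivative, and \<open>E\<close>, that of \<open>s/(s)\<^sub>j\<close>. The factor \<open>s\<close> shifts the index by one, so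
  \<open>\<gamma>\<^sub>k\<close> is the coefficient of index \<open>k + 1\<close>, and the \<open>n\<close>-th coefficient of \<open>E\<close> is \<open>d\<^sub>n\<^sub>-\<^sub>1\<close>.
\<close>
lemma barnes_gamma_eq:
  fixes d :: "int \<Rightarrow> complex"
  assumes w: "\<And>i. i \<in> {1..r} \<Longrightarrow> w i \<in> H" and a: "a \<in> H"
    and d: "\<And>s. 0 < norm s \<Longrightarrow> norm s < 1 \<Longrightarrow> ((\<lambda>n. d n * s powi n) has_sum (1 / pochhammer s j)) {-1..}"
    and k: "k \<ge> -1"
  shows "barnes_gamma L r w k j a = (-1) ^ j * (\<Sum>m=0..nat (k + 1). d (k - int m) * (1 / fact m) *
       (deriv ^^ j) (\<lambda>b. (deriv ^^ m) (barnes_zeta L r w b) 0) a)"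
proof -
  obtain G where G: "zeta_ladder r UNIV G" 
    "\<And>s a. real r < Re s \<Longrightarrow> a \<in> H \<Longrightarrow> G s a = pole_poly r s * barnes_series L r w a s"
    using barnes_continuation[where r = r and w = w] w by blast
  let ?h = "\<lambda>u. ladder_deriv r G j u a"
  define C where "C = fps_expansion ?h 0"
  define E where "E = Abs_fps (\<lambda>n. d (int n - 1))"
  have h: "?h has_fps_expansion C"
    unfolding C_def using ladder_deriv_properties(2)[OF G(1) a, of j] 
    by (intro has_fps_expansion_fps_expansion[of "ball 0 1"]) auto
  have e: "(\<lambda>s. if s = 0 then d (-1) else s * (1 / pochhammer s j)) has_fps_expansion E"
    unfolding E_def by (rule has_fps_expansion_of_has_sum_shift) (rule d)
  have "(\<lambda>s. (-1) ^ j * (?h s * (if s = 0 then d (-1) else s * (1 / pochhammer s j)))) has_fps_expansion fps_const ((-1) ^ j) * (C * E)"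
    by (intro has_fps_expansion_cmult_left has_fps_expansion_mult h e)
  from has_laurent_expansion_shift'[OF has_laurent_expansion_fps[OF this], of 1]
  have "(\<lambda>s. (-1) ^ j * (?h s * (if s = 0 then d (-1) else s * (1 / pochhammer s j))) * s powi - 1) has_laurent_expansion
      fls_shift 1 (fps_to_fls (fps_const ((-1) ^ j) * (C * E)))" .
  moreover have "eventually (\<lambda>s::complex. s \<in> ball 0 1 - {0}) (at 0)"
    by (rule eventually_at_in_open) auto
  then have "eventually (\<lambda>s. (-1) ^ j * (?h s * (if s = 0 then d (-1) else s * (1 / pochhammer s j))) * s powi - 1 =
     barnes_zeta L r w a (of_nat j + s)) (at 0)"
    by eventually_elim (simp add: barnes_zeta_shift[OF G a] power_int_minus)
  ultimately have "(\<lambda>s. barnes_zeta L r w a (of_nat j + s)) has_laurent_expansion 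
      fls_shift 1 (fps_to_fls (fps_const ((-1) ^ j) * (C * E)))"
    by (simp only: has_laurent_expansion_cong)
  then have "barnes_gamma L r w k j a = fps_nth (fps_const ((-1) ^ j) * (C * E)) (nat (k + 1))"
    unfolding barnes_gamma_def using k by (simp add: laurent_expansion_eqI)
  also have "\<dots> = (-1) ^ j * (\<Sum>m=0..nat (k + 1). fps_nth C m * fps_nth E (nat (k + 1) - m))"
    by (subst fps_mult_left_const_nth) (simp only: fps_mult_nth)
  also have "(\<Sum>m=0..nat (k + 1). fps_nth C m * fps_nth E (nat (k + 1) - m)) = 
      (\<Sum>m=0..nat (k + 1). d (k - int m) * (1 / fact m) * (deriv ^^ j) (\<lambda>b. (deriv ^^ m) (barnes_zeta L r w b) 0) a)"
  proof (rule sum.cong)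
    fix m assume "m \<in> {0..nat (k + 1)}"
    then have "int (nat (k + 1) - m) - 1 = k - int m" using k by auto
    then show "fps_nth C m * fps_nth E (nat (k + 1) - m) =
      d (k - int m) * (1 / fact m) * (deriv ^^ j) (\<lambda>b. (deriv ^^ m) (barnes_zeta L r w b) 0) a"
      by (simp add: C_def E_def fps_expansion_def deriv_a_deriv_s_barnes_zeta[OF G a])
  qed simp
  finally show ?thesis .
qed

end

theorem theorem1p3:
  fixes r :: nat and \<phi> :: real and L :: "complex \<Rightarrow> complex"
    and a :: complex and w :: "nat \<Rightarrow> complex" and d :: "nat \<Rightarrow> int \<Rightarrow> complex"
    and j :: nat and k :: int
  assumes "r \<ge> 2"
    and "-pi < \<phi>" and "\<phi> < pi"
    and "is_holo_log L (barnes_halfplane \<phi>)"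
    and "a \<in> barnes_halfplane \<phi>"
    and "\<And>i. i \<in> {1..r} \<Longrightarrow> w i \<in> barnes_halfplane \<phi>"
    and "\<And>i s. i \<in> {1..r-1} \<Longrightarrow> 0 < norm s \<Longrightarrow> norm s < 1 \<Longrightarrow>
           ((\<lambda>n. d i n * s powi n) has_sum (1 / pochhammer s i)) {-1..}"
    and "j \<in> {1..r-1}" and "k \<ge> -1"
  shows "barnes_gamma L r w k j a =
    (-1) ^ j * (\<Sum>m=0..nat (k + 1). d j (k - int m) * (1 / fact m) *
       (deriv ^^ j) (\<lambda>b. (deriv ^^ m) (barnes_zeta L r w b) 0) a)"
proof -
  interpret log_on_halfplane \<phi> L
    by unfold_locales fact+
  show ?thesis
    by (rule barnes_gamma_eq[OF assms(6,5) assms(7)[OF assms(8)] assms(9)])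
qed

end
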